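(* Let $K$ be an algebraically closed field which is not absolutely algebraic, let $n\geq1$ and let $X_1,\ldots,X_n$ be indeterminates over $K$; put $T=K[X_1,\ldots,X_n]$. Then for each prime ideal $Q$ of $T$ with $n-1\leq \mathrm{ht}(Q)\leq n$, there exists a maximal subring $S$ of $T$ which is integrally closed in $T$ with $(S:T)=Q$.
   Context: All rings are commutative with $1\neq0$ and subrings are unital. A field is absolutely algebraic if it is algebraic over $\mathbb{F}_p$ for some prime $p$. A maximal subring of $T$ is a proper subring maximal with respect to inclusion among proper subrings of $T$. The conductor is $(S:T)=\{x\in T\mid Tx\subseteq S\}$. *)

theory Defs
  imports "HOL-Computational_Algebra.Polynomial" "HOL-Library.Poly_Mapping" "HOL-Library.Extended_Nat" "HOL-Library.Cardinality"
begin

text \<open>The polynomial ring K[X_1,...,X_n] is rendered as the type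
  (v =>0 nat) =>0 k with a finite variable type 'v (n = CARD('v)):
  finitely supported maps from monomials (exponent vectors) to coefficients.\<close>

definition absolutely_algebraic :: "'k::field itself \<Rightarrow> bool" where
  "absolutely_algebraic _ \<longleftrightarrow>
     (\<exists>p. prime p \<and> CHAR('k) = p \<and>
        (\<forall>x::'k. \<exists>q::'k poly. q \<noteq> 0 \<and> (\<forall>i. coeff q i \<in> range of_nat) \<and> poly q x = 0))"

definition is_subring :: "'a::comm_ring_1 set \<Rightarrow> bool" where
  "is_subring S \<longleftrightarrow> 0 \<in> S \<and> 1 \<in> S \<and>
     (\<forall>x\<in>S. \<forall>y\<in>S. x + y \<in> S \<and> x - y \<in> S \<and> x * y \<in> S)"

definition maximal_subring :: "'a::comm_ring_1 set \<Rightarrow> bool" where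
  "maximal_subring S \<longleftrightarrow> is_subring S \<and> S \<noteq> UNIV \<and>
     (\<forall>S'. is_subring S' \<and> S \<subseteq> S' \<and> S' \<noteq> UNIV \<longrightarrow> S' = S)"

definition integral_over :: "'a::comm_ring_1 set \<Rightarrow> 'a \<Rightarrow> bool" where
  "integral_over S t \<longleftrightarrow>
     (\<exists>q::'a poly. lead_coeff q = 1 \<and> (\<forall>i. coeff q i \<in> S) \<and> poly q t = 0)"

definition integrally_closed_in_ambient :: "'a::comm_ring_1 set \<Rightarrow> bool" where
  "integrally_closed_in_ambient S \<longleftrightarrow> (\<forall>t. integral_over S t \<longrightarrow> t \<in> S)"

definition conductor :: "'a::comm_ring_1 set \<Rightarrow> 'a set" where
  "conductor S = {x. \<forall>t. t * x \<in> S}"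

definition is_ideal :: "'a::comm_ring_1 set \<Rightarrow> bool" where
  "is_ideal I \<longleftrightarrow> 0 \<in> I \<and> (\<forall>x\<in>I. \<forall>y\<in>I. x + y \<in> I) \<and> (\<forall>x\<in>I. \<forall>r. r * x \<in> I)"

definition prime_ideal :: "'a::comm_ring_1 set \<Rightarrow> bool" where
  "prime_ideal P \<longleftrightarrow> is_ideal P \<and> P \<noteq> UNIV \<and> (\<forall>a b. a * b \<in> P \<longrightarrow> a \<in> P \<or> b \<in> P)"

definition height :: "'a::comm_ring_1 set \<Rightarrow> enat" where
  "height Q = Sup {enat k | k. \<exists>f :: nat \<Rightarrow> 'a set.
      (\<forall>i\<le>k. prime_ideal (f i)) \<and> (\<forall>i<k. f i \<subset> f (Suc i)) \<and> f k = Q}"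

end

theory Submission
  imports Defs "HOL-Library.FuncSet"
begin

text \<open>For a prime \<open>Q\<close> of \<open>T\<close> with \<open>ht Q \<ge> n - 1\<close>, any two elements of \<open>T/Q\<close> are algebraically dependent
  over \<open>K\<close>: along a chain of primes the growth of the residue rings drops by a degree at each step, and
  the polynomial ring has growth \<open>n\<close>. Choose \<open>B \<subseteq> K\<close> with \<open>K\<close> algebraic over \<open>B\<close> and \<open>y \<in> B\<close>, either
  \<open>B = \<int>\<close>, \<open>y = 2\<close> or \<open>B = L[y]\<close> with \<open>y\<close> transcendental over a subfield \<open>L\<close> maximal with this property. If \<open>T/Q\<close> is algebraic over
  \<open>K\<close> we take the \<open>y\<close>-adic valuation of \<open>B\<close>; otherwise \<open>T/Q\<close> is algebraic over \<open>B[t]\<close> for some transcendental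
  \<open>t\<close>, and \<open>B[t]\<close> inherits a discrete valuation with the same residue field from an embedding into the
  \<open>y\<close>-adic completion of \<open>B\<close> that sends \<open>t\<close> to a Liouville series. Let \<open>(S, M)\<close> be a maximal pair of a
  subring of \<open>T\<close> and a proper ideal dominating the valuation pair. By algebraicity it is a Manis valuation
  pair of rank one with kernel \<open>Q\<close> whose completion has \<open>T/Q\<close> as a dense subring (every \<open>x \<notin> Q\<close> has some \<open>d \<in> T\<close>
  with \<open>1 - x d \<in> M\<close>), and this forces \<open>S\<close> to be a maximal subring, integrally closed, with conductor \<open>Q\<close>.\<close>

section \<open>Maximal pairs\<close>

text \<open>The ring \<open>T/Q\<close> is never formed; relations are congruences modulo
  \<open>Q\<close> inside \<open>T\<close>. The choice of valuation is dictated by what can be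
  inverted in \<open>T\<close>: a pair \<open>(A, I)\<close> controls the maximal pairs above it
  only if no element of \<open>A - I\<close> can fall into \<open>M\<close>, and inverses modulo
  \<open>I\<close> within \<open>A\<close> ensure this. A Gauss extension to \<open>B[t]\<close>
  would add the class of \<open>t\<close> to the residue field, and \<open>T\<close> need not supply
  its inverse. So the valuation on \<open>B[t]\<close> should be immediate over \<open>B\<close>,
  and inverses are then found in \<open>B\<close> itself. Embedding into the \<open>y\<close>-adic
  completion achieves this; the embedding must be injective, whence the Liouville limit. A size
  function, the absolute value on \<open>\<int>\<close> and \<open>2 ^ degree\<close> on
  \<open>L[y]\<close>, lets one estimate serve both choices of \<open>B\<close>. Relations are
  needed with coefficients in \<open>B\<close>, so growth is counted over the fraction field of
  \<open>B\<close>. As \<open>K\<close> is algebraic over it, the coefficients occurring in one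
  count lie in a finite extension, which costs only a constant factor.\<close>

lemma is_subringD:
  assumes "is_subring S"
  shows "0 \<in> S" "1 \<in> S" "\<And>x y. x \<in> S \<Longrightarrow> y \<in> S \<Longrightarrow> x + y \<in> S"
    "\<And>x y. x \<in> S \<Longrightarrow> y \<in> S \<Longrightarrow> x - y \<in> S" "\<And>x y. x \<in> S \<Longrightarrow> y \<in> S \<Longrightarrow> x * y \<in> S"
  using assms by (auto simp: is_subring_def)

lemma is_subring_uminus: "is_subring S \<Longrightarrow> x \<in> S \<Longrightarrow> - x \<in> S"
  using is_subringD(1,4)[of S] by (metis diff_0)

lemma is_subring_power: "is_subring S \<Longrightarrow> x \<in> S \<Longrightarrow> x ^ n \<in> S"
  by (induction n) (auto simp: is_subringD)

lemma is_subring_sum: "is_subring S \<Longrightarrow> (\<And>i. i \<in> I \<Longrightarrow> f i \<in> S) \<Longrightarrow> sum f I \<in> S"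
  by (induction I rule: infinite_finite_induct) (auto simp: is_subringD)

text \<open>No inclusion in \<open>S\<close> is demanded, so the notion covers ideals of
  \<open>S\<close>, the ring \<open>S\<close> itself and, for \<open>S = UNIV\<close>, ideals of the
  ambient ring.\<close>

definition submod :: "'a::comm_ring_1 set \<Rightarrow> 'a set \<Rightarrow> bool" where
  "submod S M \<longleftrightarrow> 0 \<in> M \<and> (\<forall>x\<in>M. \<forall>y\<in>M. x + y \<in> M) \<and> (\<forall>s\<in>S. \<forall>x\<in>M. s * x \<in> M)"

lemma submodD:
  assumes "submod S M"
  shows "0 \<in> M" "\<And>x y. x \<in> M \<Longrightarrow> y \<in> M \<Longrightarrow> x + y \<in> M" "\<And>s x. s \<in> S \<Longrightarrow> x \<in> M \<Longrightarrow> s * x \<in> M"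
    "\<And>s x. s \<in> S \<Longrightarrow> x \<in> M \<Longrightarrow> x * s \<in> M"
  using assms by (auto simp: submod_def mult.commute)

lemma submod_uminus: "is_subring S \<Longrightarrow> submod S M \<Longrightarrow> x \<in> M \<Longrightarrow> - x \<in> M"
  using submodD(3)[of S M "-1" x] is_subring_uminus[of S 1] is_subringD(2)[of S] by simp

lemma submod_diff: "is_subring S \<Longrightarrow> submod S M \<Longrightarrow> x \<in> M \<Longrightarrow> y \<in> M \<Longrightarrow> x - y \<in> M"
  using submodD(2)[of S M x "-y"] submod_uminus[of S M y] by simp

lemma submod_sum: "submod S M \<Longrightarrow> (\<And>i. i \<in> I \<Longrightarrow> f i \<in> M) \<Longrightarrow> sum f I \<in> M"
  by (induction I rule: infinite_finite_induct) (auto simp: submodD)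

lemma submod_self: "is_subring S \<Longrightarrow> submod S S"
  by (auto simp: submod_def is_subringD)

lemma submod_UNIV: "is_ideal Q \<longleftrightarrow> submod UNIV Q"
  by (auto simp: submod_def is_ideal_def)

lemma is_subring_UNIV: "is_subring UNIV"
  by (simp add: is_subring_def)

section \<open>Reduction by monic polynomials and elimination modulo a prime\<close>

lemma poly_eq_sum_lessThan:
  fixes x :: "'a::comm_ring_1"
  assumes "\<And>i. n \<le> i \<Longrightarrow> coeff p i = 0"
  shows "poly p x = (\<Sum>i<n. coeff p i * x ^ i)"
proof -
  have "poly p x = (\<Sum>i\<le>degree p. coeff p i * x ^ i)" by (simp add: poly_altdef)
  also have "\<dots> = (\<Sum>i\<in>{..degree p} \<inter> {..<n}. coeff p i * x ^ i)"
    by (rule sum.mono_neutral_right) (use assms in \<open>auto simp: not_less\<close>)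
  also have "\<dots> = (\<Sum>i<n. coeff p i * x ^ i)"
    by (rule sum.mono_neutral_left) (auto intro: le_degree)
  finally show ?thesis .
qed

text \<open>Horner's scheme: prepending a coefficient to a remainder of degree below
  \<open>degree q\<close> creates at most one term of degree \<open>degree q\<close>, which a
  multiple of \<open>q\<close> removes. The factor is a coefficient in \<open>I\<close>, so
  remainders keep their coefficients there.\<close>

lemma reduce_mod_monic:
  fixes x :: "'a::comm_ring_1"
  assumes S: "is_subring S" and I: "submod S I"
    and q: "lead_coeff q = 1" "\<And>i. coeff q i \<in> S" "poly q x = 0" and p: "\<And>i. coeff p i \<in> I"
  shows "\<exists>r. (\<forall>i. coeff r i \<in> I) \<and> (\<forall>i\<ge>degree q. coeff r i = 0) \<and> poly r x = poly p x"
  using p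
proof (induction p)
  case 0
  then show ?case by (intro exI[of _ 0]) (auto simp: submodD[OF I])
next
  case (pCons a p)
  have aI: "a \<in> I" and "\<And>i. coeff p i \<in> I"
    using pCons.prems[of 0] pCons.prems[of "Suc _"] by auto
  then obtain r where r: "\<And>i. coeff r i \<in> I" "\<And>i. i \<ge> degree q \<Longrightarrow> coeff r i = 0" "poly r x = poly p x"
    using pCons.IH by blast
  define c where "c = coeff (pCons a r) (degree q)"
  define r' where "r' = pCons a r - smult c q"
  have co: "coeff (pCons a r) i \<in> I" for i using aI r(1) by (simp add: coeff_pCons split: nat.split)
  have "coeff r' i \<in> I" for i
    unfolding r'_def coeff_diff coeff_smult
    by (intro submod_diff[OF S I] co submodD(4)[OF I] q) (simp add: c_def co)
  moreover have "coeff r' i = 0" if "i \<ge> degree q" for i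
  proof (cases "i = degree q")
    case True
    then show ?thesis using q by (simp add: r'_def c_def)
  next
    case False
    then have "i > degree q" using that by simp
    then show ?thesis using r(2)[of "i - 1"] by (cases i) (auto simp: r'_def coeff_eq_0)
  qed
  moreover have "poly r' x = poly (pCons a p) x"
    by (simp add: r'_def r(3) q(3))
  ultimately show ?case by blast
qed

lemma coeff_sum_monom: "coeff (\<Sum>i<n. monom (c i) i) j = (if j < n then c j else 0)"
proof -
  have "(\<Sum>i<n. coeff (monom (c i) i) j) = (\<Sum>i<n. if i = j then c i else 0)"
    by (rule sum.cong) auto
  then show ?thesis by (auto simp: coeff_sum)
qed

lemma integral_overI:
  fixes x :: "'a::comm_ring_1"
  assumes S: "is_subring S" and c: "\<And>i. i < n \<Longrightarrow> c i \<in> S"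
    and eq: "x ^ n + (\<Sum>i<n. c i * x ^ i) = 0"
  shows "integral_over S x"
proof -
  define q where "q = monom 1 n + (\<Sum>i<n. monom (c i) i)"
  have co: "coeff q j = (if j = n then 1 else if j < n then c j else 0)" for j
    by (auto simp: q_def coeff_sum_monom)
  have "degree q = n"
  proof (rule antisym)
    show "degree q \<le> n" by (rule degree_le) (auto simp: co)
    show "n \<le> degree q" by (rule le_degree) (auto simp: co)
  qed
  then have "lead_coeff q = 1" by (simp add: co)
  moreover have "\<forall>i. coeff q i \<in> S" using c is_subringD[OF S] by (auto simp: co)
  moreover have "poly q x = 0" using eq by (simp add: q_def poly_sum poly_monom)
  ultimately show ?thesis unfolding integral_over_def by blast
qed

text \<open>Nakayama's lemma by Gaussian elimination: a matrix that is invertible modulo the prime \<open>M\<close>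
  because it is diagonal there kills a vector only up to an element outside \<open>M\<close>.\<close>

lemma diagonal_mod_prime_kernel:
  fixes A :: "nat \<Rightarrow> nat \<Rightarrow> 'a::comm_ring_1"
  assumes S: "is_subring S" and M: "submod S M" "1 \<notin> M"
    and prime: "\<And>s t. s \<in> S \<Longrightarrow> t \<in> S \<Longrightarrow> s \<notin> M \<Longrightarrow> t \<notin> M \<Longrightarrow> s * t \<notin> M"
  shows "(\<And>j i. j < k \<Longrightarrow> i < k \<Longrightarrow> A j i \<in> S) \<Longrightarrow> (\<And>j. j < k \<Longrightarrow> A j j \<notin> M) \<Longrightarrow>
    (\<And>j i. j < k \<Longrightarrow> i < k \<Longrightarrow> i \<noteq> j \<Longrightarrow> A j i \<in> M) \<Longrightarrow>
    (\<And>j. j < k \<Longrightarrow> (\<Sum>i<k. A j i * z i) = 0) \<Longrightarrow> \<exists>s\<in>S. s \<notin> M \<and> (\<forall>j<k. s * z j = 0)"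
proof (induction k arbitrary: A)
  case 0
  then show ?case using M is_subringD(2)[OF S] by auto
next
  case (Suc k)
  \<comment> \<open>Elimination without division. The diagonal stays outside \<open>M\<close> by
    primality, since the correction \<open>A j k * A k j\<close> lies in \<open>M\<close>.\<close>
  define A' where "A' j i = A k k * A j i - A j k * A k i" for j i
  have "\<exists>s\<in>S. s \<notin> M \<and> (\<forall>j<k. s * z j = 0)"
  proof (rule Suc.IH[of A'])
    fix j i assume ji: "j < k" "i < k"
    show "A' j i \<in> S" unfolding A'_def using ji by (intro is_subringD[OF S] Suc.prems) auto
    show "A' j i \<in> M" if "i \<noteq> j"
      unfolding A'_def using ji that
      by (intro submod_diff[OF S M(1)] submodD(3)[OF M(1)] Suc.prems) auto
  next
    fix j assume j: "j < k"
    show "A' j j \<notin> M"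
    proof
      assume "A' j j \<in> M"
      moreover have "A j k * A k j \<in> M"
        using j by (intro submodD(3)[OF M(1)] Suc.prems) auto
      ultimately have "A k k * A j j \<in> M"
        using submodD(2)[OF M(1), of "A' j j" "A j k * A k j"] by (simp add: A'_def)
      then show False using prime[of "A k k" "A j j"] Suc.prems j by auto
    qed
    have 1: "(\<Sum>i<k. A j i * z i) = - (A j k * z k)" and 2: "(\<Sum>i<k. A k i * z i) = - (A k k * z k)"
      using Suc.prems(4)[of j] Suc.prems(4)[of k] j by (auto simp: eq_neg_iff_add_eq_0)
    have "(\<Sum>i<k. A' j i * z i) = A k k * (\<Sum>i<k. A j i * z i) - A j k * (\<Sum>i<k. A k i * z i)"
      by (simp add: A'_def sum_distrib_left sum_subtractf algebra_simps)
    also have "\<dots> = 0" unfolding 1 2 by (simp add: algebra_simps)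
    finally show "(\<Sum>i<k. A' j i * z i) = 0" .
  qed
  then obtain s where s: "s \<in> S" "s \<notin> M" "\<And>j. j < k \<Longrightarrow> s * z j = 0" by blast
  have sk: "s * A k k * z j = 0" if "j < k" for j
    using s(3)[OF that] by (metis mult.assoc mult.commute mult_zero_left)
  have "s * A k k * z k = - (\<Sum>i<k. s * (A k i * z i))"
    using Suc.prems(4)[of k] by (simp add: sum_distrib_left[symmetric] mult.assoc eq_neg_iff_add_eq_0 flip: distrib_left) (simp add: add.commute)
  also have "(\<Sum>i<k. s * (A k i * z i)) = 0"
    using s(3) by (intro sum.neutral) (metis lessThan_iff mult.left_commute mult_zero_right)
  finally have "s * A k k * z k = 0" by simp
  with sk have "\<forall>j<Suc k. s * A k k * z j = 0" by (auto simp: less_Suc_eq)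
  moreover have "s * A k k \<in> S" "s * A k k \<notin> M"
    using s Suc.prems prime is_subringD(5)[OF S] by auto
  ultimately show ?case by blast
qed

text \<open>\<open>V S\<close> is the ring \<open>S[x]\<close> and \<open>V I\<close> the
  \<open>S[x]\<close>-module generated by \<open>I\<close>. For \<open>I = M\<close> they form the
  pair that is tested against the maximality of \<open>(S, M)\<close>.\<close>

lemma ideal_poly_values:
  fixes x :: "'a::comm_ring_1"
  assumes S: "is_subring S" and I: "submod S I"
  defines "V \<equiv> (\<lambda>I. {poly p x | p. \<forall>i. coeff p i \<in> I})"
  shows "submod (V S) (V I)" "I \<subseteq> V I"
proof -
  have 0: "0 \<in> V I" unfolding V_def using submodD(1)[OF I] by (force intro!: exI[of _ 0])
  have "a + b \<in> V I" if "a \<in> V I" "b \<in> V I" for a b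
  proof -
    obtain p q where "a = poly p x" "\<forall>i. coeff p i \<in> I" "b = poly q x" "\<forall>i. coeff q i \<in> I"
      using \<open>a \<in> V I\<close> \<open>b \<in> V I\<close> unfolding V_def by auto
    then show ?thesis unfolding V_def by (force intro!: exI[of _ "p + q"] submodD[OF I])
  qed
  moreover have "a * b \<in> V I" if "a \<in> V S" "b \<in> V I" for a b
  proof -
    obtain p q where "a = poly p x" "\<forall>i. coeff p i \<in> S" "b = poly q x" "\<forall>i. coeff q i \<in> I"
      using \<open>a \<in> V S\<close> \<open>b \<in> V I\<close> unfolding V_def by auto
    then show ?thesis unfolding V_def
      by (force intro!: exI[of _ "p * q"] submod_sum[OF I] submodD(3)[OF I] simp: coeff_mult)
  qed
  ultimately show "submod (V S) (V I)" using 0 by (auto simp: submod_def)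
  show "I \<subseteq> V I"
  proof
    fix a assume "a \<in> I"
    then show "a \<in> V I" unfolding V_def using submodD(1)[OF I]
      by (force intro!: exI[of _ "[:a:]"] simp: coeff_pCons split: nat.split)
  qed
qed

lemma subring_poly_values:
  fixes x :: "'a::comm_ring_1"
  assumes S: "is_subring S"
  defines "V \<equiv> {poly p x | p. \<forall>i. coeff p i \<in> S}"
  shows "is_subring V" "S \<subseteq> V" "x \<in> V"
proof -
  note V = ideal_poly_values[OF S submod_self[OF S], of x, folded V_def]
  show "S \<subseteq> V" by (rule V(2))
  then have "1 \<in> V" "-1 \<in> V" using is_subringD[OF S] is_subring_uminus[OF S] by auto
  moreover have "a - b \<in> V" if "a \<in> V" "b \<in> V" for a b
    using submodD(2)[OF V(1) that(1) submodD(3)[OF V(1) \<open>-1 \<in> V\<close> that(2)]] by simp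
  ultimately show "is_subring V" using submodD[OF V(1)] by (auto simp: is_subring_def)
  show "x \<in> V" unfolding V_def using is_subringD[OF S]
    by (force intro!: exI[of _ "[:0, 1:]"] simp: coeff_pCons split: nat.split)
qed

locale maximal_pair =
  fixes S M :: "'a::comm_ring_1 set"
  assumes subring: "is_subring S" and M_subset: "M \<subseteq> S" and submod: "submod S M" and one: "1 \<notin> M"
    and maximal: "\<And>S' M'. is_subring S' \<Longrightarrow> M' \<subseteq> S' \<Longrightarrow> submod S' M' \<Longrightarrow> 1 \<notin> M' \<Longrightarrow>
      S \<subseteq> S' \<Longrightarrow> M \<subseteq> M' \<Longrightarrow> S' = S \<and> M' = M"
begin

lemmas S_closed = is_subringD[OF subring] is_subring_uminus[OF subring]
  is_subring_power[OF subring] is_subring_sum[OF subring]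
lemmas M_closed = submodD[OF submod] submod_uminus[OF subring submod]
  submod_diff[OF subring submod] submod_sum[OF submod]

text \<open>With the ring fixed, maximality says that \<open>M\<close> is a maximal ideal of
  \<open>S\<close>, so \<open>M + S s\<close> contains 1.\<close>

lemma residue_inverse:
  assumes s: "s \<in> S" "s \<notin> M"
  obtains r where "r \<in> S" "1 - r * s \<in> M"
proof -
  define N where "N = {m + r * s | m r. m \<in> M \<and> r \<in> S}"
  have NI: "m + r * s \<in> N" if "m \<in> M" "r \<in> S" for m r using that by (auto simp: N_def)
  have "submod S N"
    unfolding submod_def
  proof (intro conjI ballI)
    show "0 \<in> N" using NI[of 0 0] M_closed S_closed by simp
    fix a b assume "a \<in> N"
    then obtain m r where a: "a = m + r * s" "m \<in> M" "r \<in> S" by (auto simp: N_def)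
    {
      assume "b \<in> N"
      then obtain m' r' where b: "b = m' + r' * s" "m' \<in> M" "r' \<in> S" by (auto simp: N_def)
      show "a + b \<in> N" using NI[of "m + m'" "r + r'"] a b M_closed S_closed
        by (simp add: algebra_simps)
    }
    assume "b \<in> S"
    then show "b * a \<in> N" using NI[of "b * m" "b * r"] a M_closed S_closed
      by (simp add: algebra_simps)
  qed
  moreover have "N \<subseteq> S" using s M_subset S_closed by (auto simp: N_def)
  moreover have "M \<subseteq> N" using NI[of _ 0] S_closed by auto
  moreover have "N \<noteq> M" using NI[of 0 1] M_closed S_closed s by auto
  ultimately have "1 \<in> N" using maximal[OF subring, of N] by auto
  then obtain m r where "1 = m + r * s" "m \<in> M" "r \<in> S" by (auto simp: N_def)
  moreover from this have "1 - r * s = m" by (simp add: algebra_simps)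
  ultimately show thesis using that[of r] by simp
qed

lemma prime:
  assumes "s \<in> S" "t \<in> S" "s \<notin> M" "t \<notin> M"
  shows "s * t \<notin> M"
proof
  assume st: "s * t \<in> M"
  obtain r where r: "r \<in> S" "1 - r * s \<in> M" using residue_inverse assms by blast
  have "(1 - r * s) * t + r * (s * t) \<in> M"
    using r st assms M_closed(2) M_closed(3)[of r "s * t"] M_closed(4)[of t "1 - r * s"] by blast
  then show False using assms by (simp add: algebra_simps)
qed

lemma prime_power: "s \<in> S \<Longrightarrow> s \<notin> M \<Longrightarrow> s ^ n \<notin> M"
  by (induction n) (auto simp: one prime S_closed)

text \<open>The ring \<open>S[x]\<close> is larger than \<open>S\<close>, so the ideal generated by
  \<open>M\<close> in it cannot be proper.\<close>

lemma one_in_extension: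
  assumes "x \<notin> S"
  obtains p where "\<And>i. coeff p i \<in> M" "poly p x = 1"
proof -
  define V where "V = (\<lambda>I. {poly p x | p. \<forall>i. coeff p i \<in> I})"
  note VS = subring_poly_values[OF subring, of x] 
  note VM = ideal_poly_values[OF subring submod, of x]
  have "V M \<subseteq> V S" using M_subset by (auto simp: V_def)
  moreover have "V S \<noteq> S" using assms VS(3) by (auto simp: V_def)
  ultimately have "1 \<in> V M" using maximal[of "V S" "V M"] VS VM by (auto simp: V_def)
  then show thesis using that by (auto simp: V_def)
qed

text \<open>Nakayama: for integral \<open>x\<close> the module \<open>S[x]\<close> is finitely
  generated, and 1 in \<open>M S[x]\<close> makes the two equal. Concretely, every power
  \<open>x ^ j\<close> is a combination of the powers below \<open>k\<close> with coefficients in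
  \<open>M\<close>, and the identity minus this matrix annihilates the vector of powers, whose first
  entry is 1.\<close>

lemma integral_imp_mem:
  assumes "integral_over S x"
  shows "x \<in> S"
proof (rule ccontr)
  assume "x \<notin> S"
  then obtain p where p: "\<And>i. coeff p i \<in> M" "poly p x = 1" using one_in_extension by blast
  obtain q where q: "lead_coeff q = 1" "\<And>i. coeff q i \<in> S" "poly q x = 0"
    using assms by (auto simp: integral_over_def)
  define k where "k = degree q"
  have "\<exists>r. (\<forall>i. coeff r i \<in> M) \<and> (\<forall>i\<ge>degree q. coeff r i = 0) \<and> poly r x = poly (monom 1 j * p) x" for j
    by (rule reduce_mod_monic[OF subring submod q])
      (use p M_closed in \<open>auto simp: coeff_monom_mult\<close>)
  then obtain R where R: "\<And>j i. coeff (R j) i \<in> M" "\<And>j i. i \<ge> k \<Longrightarrow> coeff (R j) i = 0"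
    "\<And>j. poly (R j) x = x ^ j"
    unfolding k_def using p by (simp add: poly_monom) metis
  have Rsum: "(\<Sum>i<k. coeff (R j) i * x ^ i) = x ^ j" for j
    using poly_eq_sum_lessThan[of k "R j" x] R by simp
  define A where "A j i = (if i = j then 1 else 0) - coeff (R j) i" for j i
  have "\<exists>s\<in>S. s \<notin> M \<and> (\<forall>j<k. s * x ^ j = 0)"
  proof (rule diagonal_mod_prime_kernel[OF subring submod one prime, of k A])
    show "A j i \<in> S" for j i using R(1)[of j i] M_subset S_closed by (auto simp: A_def)
    show "A j i \<in> M" if "i \<noteq> j" for j i using R(1) that M_closed by (auto simp: A_def)
    show "A j j \<notin> M" for j
    proof
      assume "A j j \<in> M"
      then have "A j j + coeff (R j) j \<in> M" using R(1) by (intro M_closed)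
      then show False using one by (simp add: A_def)
    qed
    show "(\<Sum>i<k. A j i * x ^ i) = 0" if "j < k" for j
    proof -
      have "(\<Sum>i<k. A j i * x ^ i) = (\<Sum>i<k. (if i = j then x ^ i else 0) - coeff (R j) i * x ^ i)"
        by (rule sum.cong) (auto simp: A_def algebra_simps)
      also have "\<dots> = x ^ j - x ^ j"
        using that by (simp add: sum_subtractf Rsum)
      finally show ?thesis by simp
    qed
  qed
  then obtain s where s: "s \<in> S" "s \<notin> M" "\<And>j. j < k \<Longrightarrow> s * x ^ j = 0" by blast
  have "k \<noteq> 0"
  proof
    assume "k = 0"
    then have "(1::'a) = 0" using Rsum[of 0] by simp
    then show False using one M_closed(1) by simp
  qed
  then have "s = 0" using s(3)[of 0] by simp
  then show False using s M_closed by simp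
qed

text \<open>Hence \<open>(S, M)\<close> is a valuation pair in the sense of Manis.\<close>

lemma inverse_in_M:
  assumes "x \<notin> S"
  obtains m where "m \<in> M" "1 - x * m \<in> M"
proof -
  \<comment> \<open>Descent on the degree. The leading coefficient \<open>a\<close> makes
    \<open>a * x\<close> integral over \<open>S\<close>. Either \<open>a * x\<close> is outside
    \<open>M\<close>, and \<open>m = a\<close> serves, or the leading term can be absorbed as
    \<open>(a * x) * x ^ n\<close> with its coefficient still in \<open>M\<close>.\<close>
  have *: "\<exists>m\<in>M. x * m \<in> S \<and> x * m \<notin> M"
    if "degree p \<le> n" "\<And>i. coeff p i \<in> M" "poly p x \<in> S" "poly p x \<notin> M" for n p
    using that
  proof (induction n arbitrary: p)
    case 0
    then have "poly p x = coeff p 0" by (simp add: poly_altdef)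
    then show ?case using 0 by auto
  next
    case (Suc n)
    define a where "a = coeff p (Suc n)"
    define s where "s = poly p x"
    have a: "a \<in> M" "a \<in> S" using Suc.prems M_subset by (auto simp: a_def)
    have pS: "coeff p i \<in> S" for i using Suc.prems(2)[of i] M_subset by auto
    have s_eq: "s = a * x ^ Suc n + (\<Sum>i<Suc n. coeff p i * x ^ i)"
      using poly_eq_sum_lessThan[of "Suc (Suc n)" p x] Suc.prems(1)
      by (simp add: s_def a_def coeff_eq_0)
    \<comment> \<open>This is \<open>a ^ n\<close> times \<open>s_eq\<close>, read as a monic
      equation for \<open>a * x\<close>; the term \<open>s * a ^ n\<close> joins the constant
      coefficient.\<close>
    define c where "c i = coeff p i * a ^ (n - i) - (if i = 0 then s * a ^ n else 0)" for i
    have "c i * (a * x) ^ i = a ^ n * (coeff p i * x ^ i) - (if i = 0 then s * a ^ n else 0)"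
      if "i < Suc n" for i
    proof -
      have "a ^ n = a ^ (n - i) * a ^ i" using that by (simp flip: power_add)
      then have "coeff p i * a ^ (n - i) * (a * x) ^ i = a ^ n * (coeff p i * x ^ i)"
        unfolding power_mult_distrib by (simp add: ac_simps)
      then show ?thesis by (simp add: c_def left_diff_distrib)
    qed
    then have "(\<Sum>i<Suc n. c i * (a * x) ^ i) = (\<Sum>i<Suc n. a ^ n * (coeff p i * x ^ i) - (if i = 0 then s * a ^ n else 0))"
      by (intro sum.cong) auto
    also have "\<dots> = a ^ n * (\<Sum>i<Suc n. coeff p i * x ^ i) - s * a ^ n"
      by (simp add: sum_subtractf sum_distrib_left del: sum.lessThan_Suc)
    also have "\<dots> = a ^ n * (s - a * x ^ Suc n) - s * a ^ n" using s_eq by simp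
    finally have "(a * x) ^ Suc n + (\<Sum>i<Suc n. c i * (a * x) ^ i) = 0"
      by (simp add: algebra_simps power_mult_distrib del: sum.lessThan_Suc)
    then have "integral_over S (a * x)"
      by (intro integral_overI[OF subring, of "Suc n" c])
        (use pS a Suc.prems(3) S_closed in \<open>auto simp: c_def s_def\<close>)
    then have ax: "a * x \<in> S" by (rule integral_imp_mem)
    show ?case
    proof (cases "a * x \<in> M")
      case False
      then show ?thesis using ax a by (auto simp: mult.commute)
    next
      case True
      define p' where "p' = p - monom a (Suc n) + monom (a * x) n"
      have "degree p' \<le> n"
        using Suc.prems(1) by (intro degree_le) (auto simp: p'_def a_def coeff_eq_0)
      moreover have "coeff p' i \<in> M" for i
        using Suc.prems(2) True a M_closed by (auto simp: p'_def)
      moreover have "poly p' x = poly p x" by (simp add: p'_def poly_monom algebra_simps)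
      ultimately show ?thesis using Suc.IH[of p'] Suc.prems by simp
    qed
  qed
  obtain p where p: "\<And>i. coeff p i \<in> M" "poly p x = 1" using one_in_extension assms by blast
  then obtain m where m: "m \<in> M" "x * m \<in> S" "x * m \<notin> M"
    using *[of p "degree p"] one S_closed by auto
  then obtain r where r: "r \<in> S" "1 - r * (x * m) \<in> M" using residue_inverse by blast
  have "r * m \<in> M" using m r M_closed by auto
  then show thesis using that[of "r * m"] r by (simp add: mult_ac)
qed

text \<open>A strengthening of integral closedness: the leading coefficient is only a unit modulo
  \<open>M\<close>, and the relation holds only modulo \<open>M\<close>. For \<open>z\<close>
  outside \<open>S\<close>, some \<open>m \<in> M\<close> makes \<open>w = z * m\<close> congruent
  to 1; multiplication by \<open>m ^ n\<close> leaves \<open>u * w ^ n\<close> outside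
  \<open>M\<close>, while every lower term keeps a factor \<open>m\<close>.\<close>

lemma mem_if_poly_mem:
  assumes u: "u \<in> S" "u \<notin> M" and c: "\<And>i. i < n \<Longrightarrow> c i \<in> S"
    and eq: "u * z ^ n + (\<Sum>i<n. c i * z ^ i) \<in> M"
  shows "z \<in> S"
proof (rule ccontr)
  assume "z \<notin> S"
  then obtain m where m: "m \<in> M" "1 - z * m \<in> M" using inverse_in_M by blast
  define w where "w = z * m"
  have mS: "m \<in> S" using m M_subset by auto
  have "1 - w \<in> S" using m M_subset by (auto simp: w_def)
  then have wS: "w \<in> S" using S_closed(4)[OF S_closed(2), of "1 - w"] by simp
  have wM: "w \<notin> M" using M_closed(2)[of "1 - w" w] m one by (auto simp: w_def)
  have term_M: "c i * m ^ (n - i) * w ^ i \<in> M" if "i < n" for i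
  proof -
    have "m * m ^ (n - i - 1) \<in> M" using m mS S_closed by (intro M_closed(4)) auto
    then have "m ^ (n - i) \<in> M" using that by (metis Suc_diff_Suc diff_Suc_eq_diff_pred diff_commute power_Suc)
    then show ?thesis using c[OF that] wS S_closed by (intro M_closed(4) M_closed(3)) auto
  qed
  have "m ^ n * (c i * z ^ i) = c i * m ^ (n - i) * w ^ i" if "i < n" for i
  proof -
    have "m ^ n = m ^ (n - i) * m ^ i" using that by (simp flip: power_add)
    then show ?thesis unfolding w_def power_mult_distrib by (simp add: ac_simps)
  qed
  note sum_eq = sum.cong[OF refl this[OF iffD1[OF lessThan_iff]]]
  have "m ^ n * (u * z ^ n + (\<Sum>i<n. c i * z ^ i)) = u * w ^ n + (\<Sum>i<n. c i * m ^ (n - i) * w ^ i)"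
  proof -
    have "m ^ n * (\<Sum>i<n. c i * z ^ i) = (\<Sum>i<n. c i * m ^ (n - i) * w ^ i)"
      unfolding sum_distrib_left by (rule sum_eq)
    moreover have "m ^ n * (u * z ^ n) = u * w ^ n"
      unfolding w_def power_mult_distrib by (simp add: ac_simps)
    ultimately show ?thesis by (simp add: distrib_left)
  qed
  moreover have "m ^ n * (u * z ^ n + (\<Sum>i<n. c i * z ^ i)) \<in> M"
    by (rule M_closed(3)[OF S_closed(7)[OF mS] eq])
  ultimately have "u * w ^ n + (\<Sum>i<n. c i * m ^ (n - i) * w ^ i) \<in> M" by simp
  then have "u * w ^ n \<in> M"
    using M_closed(6)[of "u * w ^ n + (\<Sum>i<n. c i * m ^ (n - i) * w ^ i)" "\<Sum>i<n. c i * m ^ (n - i) * w ^ i"]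
      M_closed(7)[of "{..<n}" "\<lambda>i. c i * m ^ (n - i) * w ^ i"] term_M by simp
  then show False using prime[of u "w ^ n"] u wS wM prime_power S_closed by auto
qed

end

text \<open>Zorn's lemma, with a pair coded as one set of tagged elements (\<open>True\<close> for
  the ring, \<open>False\<close> for the ideal), which turns the componentwise order into
  inclusion.\<close>

lemma maximal_pair_exists:
  assumes A: "is_subring A" "I \<subseteq> A" "submod A I" "1 \<notin> I"
  obtains S M where "maximal_pair S M" "A \<subseteq> S" "I \<subseteq> M"
proof -
  define fs sn where "fs z = {x::'a. (x, True) \<in> z}" and "sn z = {x::'a. (x, False) \<in> z}" for z
  define ok where "ok z \<longleftrightarrow> is_subring (fs z) \<and> sn z \<subseteq> fs z \<and> submod (fs z) (sn z) \<and> 1 \<notin> sn z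
    \<and> A \<subseteq> fs z \<and> I \<subseteq> sn z" for z
  define pk where "pk S M = S \<times> {True} \<union> M \<times> {False}" for S M :: "'a set"
  have pk: "fs (pk S M) = S" "sn (pk S M) = M" for S M by (auto simp: fs_def sn_def pk_def)
  have "\<exists>m\<in>Collect ok. \<forall>z\<in>Collect ok. m \<subseteq> z \<longrightarrow> z = m"
  proof (rule subset_Zorn_nonempty)
    have "ok (pk A I)" using A by (simp add: ok_def pk)
    then show "Collect ok \<noteq> {}" by blast
    fix C assume C: "C \<noteq> {}" "subset.chain (Collect ok) C"
    have okC: "ok z" if "z \<in> C" for z using C that by (auto simp: subset.chain_def)
    have U: "fs (\<Union>C) = (\<Union>z\<in>C. fs z)" "sn (\<Union>C) = (\<Union>z\<in>C. sn z)" by (auto simp: fs_def sn_def)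
    have two: "\<exists>z\<in>C. a \<subseteq> z \<and> b \<subseteq> z" if "a \<in> C" "b \<in> C" for a b
      using C(2) that subset.chain_total[of "Collect ok" C a b] by blast
    have mono: "fs a \<subseteq> fs b" "sn a \<subseteq> sn b" if "a \<subseteq> b" for a b using that by (auto simp: fs_def sn_def)
    have "is_subring (fs (\<Union>C))"
    proof -
      have "x + y \<in> fs (\<Union>C) \<and> x - y \<in> fs (\<Union>C) \<and> x * y \<in> fs (\<Union>C)"
        if xy: "x \<in> fs (\<Union>C)" "y \<in> fs (\<Union>C)" for x y
      proof -
        obtain a b where ab: "a \<in> C" "x \<in> fs a" "b \<in> C" "y \<in> fs b" using xy by (auto simp: U)
        obtain z where z: "z \<in> C" "a \<subseteq> z" "b \<subseteq> z" using two ab by metis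
        have "x \<in> fs z" "y \<in> fs z" using mono[OF z(2)] mono[OF z(3)] ab by auto
        then have "x + y \<in> fs z \<and> x - y \<in> fs z \<and> x * y \<in> fs z"
          using okC[OF z(1)] by (auto simp: ok_def is_subringD)
        then show ?thesis using z by (auto simp: U)
      qed
      moreover have "0 \<in> fs (\<Union>C)" "1 \<in> fs (\<Union>C)"
        using C okC by (auto simp: U ok_def is_subring_def)
      ultimately show ?thesis by (auto simp: is_subring_def)
    qed
    moreover have "submod (fs (\<Union>C)) (sn (\<Union>C))"
    proof -
      have "x + y \<in> sn (\<Union>C)" if xy: "x \<in> sn (\<Union>C)" "y \<in> sn (\<Union>C)" for x y
      proof -
        obtain a b where ab: "a \<in> C" "x \<in> sn a" "b \<in> C" "y \<in> sn b" using xy by (auto simp: U)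
        obtain z where z: "z \<in> C" "a \<subseteq> z" "b \<subseteq> z" using two ab by metis
        have "x \<in> sn z" "y \<in> sn z" using mono[OF z(2)] mono[OF z(3)] ab by auto
        then have "x + y \<in> sn z" using okC[OF z(1)] by (auto simp: ok_def submodD)
        then show ?thesis using z by (auto simp: U)
      qed
      moreover have "x * y \<in> sn (\<Union>C)" if xy: "x \<in> fs (\<Union>C)" "y \<in> sn (\<Union>C)" for x y
      proof -
        obtain a b where ab: "a \<in> C" "x \<in> fs a" "b \<in> C" "y \<in> sn b" using xy by (auto simp: U)
        obtain z where z: "z \<in> C" "a \<subseteq> z" "b \<subseteq> z" using two ab by metis
        have "x \<in> fs z" "y \<in> sn z" using mono[OF z(2)] mono[OF z(3)] ab by auto
        then have "x * y \<in> sn z" using okC[OF z(1)] by (auto simp: ok_def submodD)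
        then show ?thesis using z by (auto simp: U)
      qed
      moreover have "0 \<in> sn (\<Union>C)"
        using C okC by (auto simp: U ok_def submod_def)
      ultimately show ?thesis by (auto simp: submod_def)
    qed
    moreover have "sn (\<Union>C) \<subseteq> fs (\<Union>C)" "1 \<notin> sn (\<Union>C)" "A \<subseteq> fs (\<Union>C)" "I \<subseteq> sn (\<Union>C)"
      using okC C(1) by (fastforce simp: U ok_def)+
    ultimately show "\<Union>C \<in> Collect ok" by (simp add: ok_def)
  qed
  then obtain m where m: "ok m" "\<And>z. ok z \<Longrightarrow> m \<subseteq> z \<Longrightarrow> z = m" by blast
  have "maximal_pair (fs m) (sn m)"
  proof
    fix S' M' assume *: "is_subring S'" "M' \<subseteq> S'" "submod S' M'" "1 \<notin> M'" "fs m \<subseteq> S'" "sn m \<subseteq> M'"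
    have "m \<subseteq> pk S' M'"
    proof
      fix p assume "p \<in> m"
      then show "p \<in> pk S' M'" using * by (cases p; cases "snd p") (auto simp: fs_def sn_def pk_def)
    qed
    moreover have "ok (pk S' M')" using * m(1) by (auto simp: ok_def pk)
    ultimately have "pk S' M' = m" using m(2) by blast
    then show "S' = fs m \<and> M' = sn m" using pk by metis
  qed (use m in \<open>auto simp: ok_def\<close>)
  then show thesis using that m(1) by (auto simp: ok_def)
qed

section \<open>Rank one and the conductor\<close>

text \<open>A coefficient outside \<open>Q\<close> is \<open>y ^ e\<close> times an element of
  \<open>S - M\<close>. It thus has an exact value \<open>e\<close> before any valuation is defined,
  and the terms of a relation modulo \<open>Q\<close> can be compared by their values.\<close>

locale algebraic_pair = maximal_pair S M for S M :: "'a::comm_ring_1 set" +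
  fixes Q :: "'a set" and y y' :: 'a
  assumes Q: "prime_ideal Q" "Q \<subseteq> M" and y: "y \<in> M" "y * y' = 1"
    and algebraic: "\<And>x. \<exists>p. (\<forall>i. coeff p i \<in> Q \<or> (\<exists>e. coeff p i * y' ^ e \<in> S - M)) \<and>
      (\<exists>i. coeff p i \<notin> Q) \<and> poly p x \<in> Q"
begin

lemma Q_submod: "submod UNIV Q"
  using Q by (simp add: prime_ideal_def submod_UNIV)

lemmas Q_closed = submodD[OF Q_submod, simplified] submod_uminus[OF is_subring_UNIV Q_submod]
  submod_diff[OF is_subring_UNIV Q_submod] submod_sum[OF Q_submod]

lemma Q_prime: "a * b \<in> Q \<Longrightarrow> a \<notin> Q \<Longrightarrow> b \<in> Q"
  using Q by (auto simp: prime_ideal_def)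

lemma y_in_S: "y \<in> S" and Q_sub_S: "Q \<subseteq> S"
  using y Q M_subset by auto

lemma y_power_cancel: "y ^ e * (y' ^ e * a) = a" "y' ^ e * (y ^ e * a) = a"
  using y(2) by (simp_all add: mult.assoc[symmetric] power_mult_distrib[symmetric] mult.commute[of y'])

lemma y_power_cancel': "e \<le> e' \<Longrightarrow> y ^ (e' - e) * (a * y' ^ e') = a * y' ^ e"
proof -
  assume "e \<le> e'"
  then have "y' ^ e' = y' ^ (e' - e) * y' ^ e" by (simp flip: power_add)
  then have "y ^ (e' - e) * (a * y' ^ e') = y ^ (e' - e) * (y' ^ (e' - e) * (a * y' ^ e))"
    by (simp add: mult_ac)
  then show ?thesis by (simp only: y_power_cancel)
qed

text \<open>As \<open>Q\<close> is prime, powers of \<open>x\<close> cancel from the relation for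
  \<open>x\<close> until its constant term \<open>a\<close> is outside \<open>Q\<close>. Then
  \<open>a\<close> is a multiple of \<open>x\<close> modulo \<open>Q\<close>, and
  \<open>a * y' ^ e\<close> is invertible modulo \<open>M\<close>.\<close>

lemma inverse_mod_M:
  assumes "x \<notin> Q"
  obtains d where "1 - x * d \<in> M"
proof -
  have "\<exists>a h e. a * y' ^ e \<in> S - M \<and> a + x * h \<in> Q"
    if "\<forall>i. coeff p i \<in> Q \<or> (\<exists>e. coeff p i * y' ^ e \<in> S - M)" "\<exists>i. coeff p i \<notin> Q" "poly p x \<in> Q" for p
    using that
  proof (induction p)
    case 0
    then show ?case using Q_closed(1) by simp
  next
    case (pCons a p)
    show ?case
    proof (cases "a \<in> Q")
      case False
      then obtain e where "a * y' ^ e \<in> S - M" using pCons.prems(1)[rule_format, of 0] by auto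
      then show ?thesis using pCons.prems(3) by auto
    next
      case True
      then have "(a + x * poly p x) - a \<in> Q" using pCons.prems(3) True
        by (intro Q_closed(6)) simp_all
      then have "poly p x \<in> Q" using Q_prime[of x "poly p x"] assms by simp
      moreover have "\<forall>i. coeff p i \<in> Q \<or> (\<exists>e. coeff p i * y' ^ e \<in> S - M)"
        using pCons.prems(1) by (metis coeff_pCons_Suc)
      moreover have "\<exists>i. coeff p i \<notin> Q"
        using pCons.prems(2) True by (metis coeff_pCons_0 coeff_pCons_Suc not0_implies_Suc)
      ultimately show ?thesis using pCons.IH by blast
    qed
  qed
  then obtain a h e where a: "a * y' ^ e \<in> S - M" "a + x * h \<in> Q" using algebraic[of x] by blast
  then obtain r where r: "r \<in> S" "1 - r * (a * y' ^ e) \<in> M" using residue_inverse by blast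
  have "(r * y' ^ e) * (a + x * h) \<in> M" using a Q_closed(3) Q by auto
  then have "(1 - r * (a * y' ^ e)) + (r * y' ^ e) * (a + x * h) \<in> M" by (intro M_closed(2) r)
  then show thesis using that[of "- (r * y' ^ e * h)"] by (simp add: algebra_simps)
qed

text \<open>The relation for \<open>z\<close> is rescaled into one for \<open>y ^ e * z\<close>,
  with \<open>e\<close> the value of the leading coefficient; the new leading coefficient is then a
  unit modulo \<open>M\<close>.\<close>

lemma y_power_mult_mem: "\<exists>e. y ^ e * z \<in> S"
proof -
  obtain p where p: "\<And>i. coeff p i \<in> Q \<or> (\<exists>e. coeff p i * y' ^ e \<in> S - M)"
    "\<exists>i. coeff p i \<notin> Q" "poly p z \<in> Q" using algebraic[of z] by blast
  \<comment> \<open>The degree modulo \<open>Q\<close>: coefficients above \<open>n\<close> may be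
    nonzero elements of \<open>Q\<close>.\<close>
  define n where "n = Max {i. coeff p i \<notin> Q}"
  have fin: "finite {i. coeff p i \<notin> Q}"
    by (rule finite_subset[of _ "{..degree p}"]) (use Q_closed(1) in \<open>auto intro!: le_degree\<close>)
  have n: "coeff p n \<notin> Q" using Max_in[OF fin] p(2) by (auto simp: n_def)
  have above: "coeff p i \<in> Q" if "i > n" for i
    using Max_ge[OF fin, of i] that by (auto simp: n_def)
  have coeff_S: "coeff p i \<in> S" for i
  proof (cases "coeff p i \<in> Q")
    case False
    then obtain e where "coeff p i * y' ^ e \<in> S" using p(1)[of i] by blast
    then have "y ^ e * (coeff p i * y' ^ e) \<in> S" using y_in_S S_closed by auto
    then show ?thesis using y_power_cancel(1)[of e "coeff p i"] by (simp add: mult.commute[of "coeff p i"])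
  qed (use Q_sub_S in auto)
  obtain e where e: "coeff p n * y' ^ e \<in> S - M" using p(1)[of n] n by blast
  have "(\<Sum>i\<le>degree p. coeff p i * z ^ i) - (\<Sum>i\<in>{..degree p} - {..n}. coeff p i * z ^ i) \<in> Q"
  proof (rule Q_closed(6))
    show "(\<Sum>i\<le>degree p. coeff p i * z ^ i) \<in> Q" using p(3) by (simp add: poly_altdef)
    show "(\<Sum>i\<in>{..degree p} - {..n}. coeff p i * z ^ i) \<in> Q"
      by (intro Q_closed(7) Q_closed(4) above) auto
  qed
  moreover have "n \<le> degree p" using n Q_closed(1) by (metis le_degree)
  ultimately have "(\<Sum>i\<le>n. coeff p i * z ^ i) \<in> Q"
    by (subst (asm) sum_diff[symmetric]) (auto simp: Diff_Diff_Int Int_absorb1)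
  then have *: "y' ^ e * y ^ (e * n) * (coeff p n * z ^ n + (\<Sum>i<n. coeff p i * z ^ i)) \<in> Q"
    by (intro Q_closed(3)) (simp add: lessThan_Suc_atMost[symmetric] add.commute)
  \<comment> \<open>From \<open>y ^ (e * n)\<close>, the part \<open>(y ^ e) ^ i\<close> goes to the
    power of \<open>z\<close>, and for \<open>i < n\<close> one further \<open>y ^ e\<close> is left
    to cancel \<open>y' ^ e\<close>.\<close>
  define c where "c i = coeff p i * y ^ (e * (n - i - 1))" for i
  have c: "y' ^ e * y ^ (e * n) * (coeff p i * z ^ i) = c i * (y ^ e * z) ^ i" if "i < n" for i
  proof -
    define l where "l = n - i - 1"
    have "n = 1 + l + i" using that by (simp add: l_def)
    then have "e * n = e + e * (n - i - 1) + e * i" by (simp add: algebra_simps)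
    then have "y ^ (e * n) = y ^ e * (y ^ (e * (n - i - 1)) * (y ^ e) ^ i)"
      by (simp add: power_add power_mult mult.assoc)
    then have "y' ^ e * y ^ (e * n) = y ^ (e * (n - i - 1)) * (y ^ e) ^ i"
      by (simp add: y_power_cancel)
    then show ?thesis by (simp add: c_def power_mult_distrib mult_ac)
  qed
  have "y' ^ e * y ^ (e * n) * (coeff p n * z ^ n + (\<Sum>i<n. coeff p i * z ^ i)) =
    (coeff p n * y' ^ e) * (y ^ e * z) ^ n + (\<Sum>i<n. c i * (y ^ e * z) ^ i)"
  proof -
    have "y' ^ e * y ^ (e * n) * (\<Sum>i<n. coeff p i * z ^ i) = (\<Sum>i<n. c i * (y ^ e * z) ^ i)"
      unfolding sum_distrib_left by (rule sum.cong) (auto simp: c)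
    moreover have "y' ^ e * y ^ (e * n) * (coeff p n * z ^ n) = (coeff p n * y' ^ e) * (y ^ e * z) ^ n"
      by (simp add: power_mult_distrib power_mult mult_ac)
    ultimately show ?thesis by (simp add: distrib_left)
  qed
  then have "(coeff p n * y' ^ e) * (y ^ e * z) ^ n + (\<Sum>i<n. c i * (y ^ e * z) ^ i) \<in> M"
    using * Q by auto
  then have "y ^ e * z \<in> S"
  proof (rule mem_if_poly_mem[rotated 3])
    show "c i \<in> S" for i
      unfolding c_def by (intro S_closed(5) S_closed(7) coeff_S y_in_S)
  qed (use e in auto)
  then show ?thesis by blast
qed

text \<open>This is rank one: \<open>y\<close> divides a power of \<open>m\<close>. Let
  \<open>e\<close> be the least value of a coefficient and \<open>k\<close> the first index where it
  occurs. After division by \<open>y ^ e\<close>, the terms from \<open>k\<close> on sum to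
  \<open>m ^ k\<close> times a unit modulo \<open>M\<close>, while the earlier coefficients are
  still divisible by \<open>y\<close>.\<close>

lemma power_div_y_mem:
  assumes m: "m \<in> M"
  shows "\<exists>k. y' * m ^ k \<in> S"
proof -
  obtain p where p: "\<And>i. coeff p i \<in> Q \<or> (\<exists>e. coeff p i * y' ^ e \<in> S - M)"
    "\<exists>i. coeff p i \<notin> Q" "poly p m \<in> Q" using algebraic[of m] by blast
  have mS: "m \<in> S" using m M_subset by auto
  define v where "v i = (SOME e. coeff p i * y' ^ e \<in> S - M)" for i
  have v: "coeff p i * y' ^ v i \<in> S - M" if "coeff p i \<notin> Q" for i
    unfolding v_def by (rule someI_ex) (use p(1) that in blast)
  define e where "e = (LEAST e. \<exists>i. coeff p i \<notin> Q \<and> v i = e)"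
  have e: "\<exists>i. coeff p i \<notin> Q \<and> v i = e"
    unfolding e_def by (rule LeastI_ex) (use p(2) in blast)
  have e_le: "e \<le> v i" if "coeff p i \<notin> Q" for i
    unfolding e_def by (rule Least_le) (use that in blast)
  define k where "k = (LEAST i. coeff p i \<notin> Q \<and> v i = e)"
  have k: "coeff p k \<notin> Q" "v k = e"
    using LeastI_ex[OF e] by (auto simp: k_def)
  have k_le: "coeff p i \<in> Q \<or> e < v i" if "i < k" for i
    using not_less_Least[OF that[unfolded k_def]] e_le[of i] by fastforce
  define b where "b i = coeff p i * y' ^ e" for i
  have bS: "b i \<in> S" for i
  proof (cases "coeff p i \<in> Q")
    case True
    then show ?thesis using Q_closed(4) Q_sub_S by (auto simp: b_def)
  next
    case False
    then have "y ^ (v i - e) * (coeff p i * y' ^ v i) \<in> S" using v[of i] y_in_S S_closed by auto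
    then show ?thesis using e_le[OF False] by (simp add: b_def y_power_cancel')
  qed
  have bk: "b k \<notin> M" using v[OF k(1)] k(2) by (simp add: b_def)
  have low: "y' * b i \<in> S" if i: "i < k" for i
  proof (cases "coeff p i \<in> Q")
    case True
    then show ?thesis using Q_closed(3,4) Q_sub_S by (auto simp: b_def)
  next
    case False
    then have "Suc e \<le> v i" using k_le[OF i] by simp
    then have "y' * b i = y ^ (v i - Suc e) * (coeff p i * y' ^ v i)"
      by (simp only: y_power_cancel') (simp add: b_def mult_ac)
    then show ?thesis using v[OF False] y_in_S S_closed by auto
  qed
  define n where "n = degree p"
  have "k \<le> n" using k(1) Q_closed(1) by (metis le_degree n_def)
  have "y' ^ e * poly p m \<in> Q" using p(3) by (rule Q_closed(3))
  also have "y' ^ e * poly p m = (\<Sum>i<Suc n. b i * m ^ i)"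
    unfolding poly_altdef sum_distrib_left b_def n_def lessThan_Suc_atMost by (simp add: mult_ac)
  also have "\<dots> = (\<Sum>i<k. b i * m ^ i) + (\<Sum>i=k..<Suc n. b i * m ^ i)"
    using \<open>k \<le> n\<close> unfolding lessThan_atLeast0 by (intro sum.atLeastLessThan_concat[symmetric]) auto
  also have "(\<Sum>i=k..<Suc n. b i * m ^ i) = b k * m ^ k + (\<Sum>i=Suc k..<Suc n. b i * m ^ i)"
    using \<open>k \<le> n\<close> by (intro sum.atLeast_Suc_lessThan) auto
  also have "(\<Sum>i=Suc k..<Suc n. b i * m ^ i) = m ^ k * (m * (\<Sum>i=Suc k..<Suc n. b i * m ^ (i - Suc k)))"
    unfolding sum_distrib_left
  proof (rule sum.cong[OF refl])
    fix i assume "i \<in> {Suc k..<Suc n}"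
    then have "m ^ i = m ^ k * (m * m ^ (i - Suc k))" by (simp flip: power_add power_Suc)
    then show "b i * m ^ i = m ^ k * (m * (b i * m ^ (i - Suc k)))" by (simp add: mult_ac)
  qed
  finally have Qs: "(\<Sum>i<k. b i * m ^ i) + (b k * m ^ k + m ^ k * (m * (\<Sum>i=Suc k..<Suc n. b i * m ^ (i - Suc k)))) \<in> Q" .
  define h where "h = (\<Sum>i=Suc k..<Suc n. b i * m ^ (i - Suc k))"
  define s where "s = (\<Sum>i<k. y' * b i * m ^ i)"
  define u where "u = b k + m * h"
  have "h \<in> S" unfolding h_def by (intro S_closed(8) S_closed(5) S_closed(7) bS mS)
  then have mh: "m * h \<in> M" using m by (intro M_closed)
  have uS: "u \<in> S" using mh M_subset bS S_closed by (auto simp: u_def)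
  have uM: "u \<notin> M"
  proof
    assume "u \<in> M"
    then have "u - m * h \<in> M" using mh by (rule M_closed)
    then show False using bk by (simp add: u_def)
  qed
  have sS: "s \<in> S" unfolding s_def by (intro S_closed(8) S_closed(5) S_closed(7) low mS) simp
  have "y' * ((\<Sum>i<k. b i * m ^ i) + (b k * m ^ k + m ^ k * (m * h))) \<in> Q"
    using Qs unfolding h_def[symmetric] by (rule Q_closed(3))
  also have "y' * ((\<Sum>i<k. b i * m ^ i) + (b k * m ^ k + m ^ k * (m * h))) = u * (y' * m ^ k) + s"
    by (simp add: s_def u_def sum_distrib_left algebra_simps)
  finally have "u * (y' * m ^ k) + s \<in> M" using Q by auto
  then have "y' * m ^ k \<in> S"
    using mem_if_poly_mem[OF uS uM, of 1 "\<lambda>_. s" "y' * m ^ k"] sS by simp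
  then show ?thesis by blast
qed

lemma power_mult_mem:
  assumes m: "m \<in> M"
  shows "\<exists>k. m ^ k * z \<in> S"
proof -
  obtain k where k: "y' * m ^ k \<in> S" using power_div_y_mem[OF m] by blast
  obtain e where e: "y ^ e * z \<in> S" using y_power_mult_mem by blast
  have "(y' * m ^ k) ^ e * (y ^ e * z) \<in> S" using k e S_closed by auto
  also have "(y' * m ^ k) ^ e * (y ^ e * z) = y' ^ e * (y ^ e * (m ^ (k * e) * z))"
    by (simp add: power_mult_distrib mult_ac flip: power_mult)
  also have "\<dots> = m ^ (k * e) * z" by (rule y_power_cancel)
  finally show ?thesis by blast
qed

lemma y'_notin: "y' \<notin> S"
  using y one M_closed(4)[of y' y] by auto

text \<open>A ring \<open>S'\<close> with an element \<open>x \<notin> S\<close> contains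
  \<open>w = x * m\<close>, a unit modulo \<open>M\<close>, and for any \<open>z\<close> it contains
  \<open>w ^ k * z\<close> once \<open>m ^ k * z \<in> S\<close>. Since \<open>w\<close> need not be
  invertible in \<open>S\<close>, \<open>z\<close> is recovered by a finite geometric series in
  \<open>u = 1 - r * w ^ k\<close>, cut off where \<open>u ^ j * z\<close> lies in
  \<open>S\<close>.\<close>

lemma maximal_subring_S: "maximal_subring S"
  unfolding maximal_subring_def
proof (intro conjI allI impI)
  show "is_subring S" by (rule subring)
  show "S \<noteq> UNIV" using y'_notin by auto
  fix S' assume S': "is_subring S' \<and> S \<subseteq> S' \<and> S' \<noteq> UNIV"
  show "S' = S"
  proof (rule ccontr)
    assume "S' \<noteq> S"
    then obtain x where x: "x \<in> S'" "x \<notin> S" using S' by blast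
    note S'_closed = is_subringD[OF conjunct1[OF S']] is_subring_power[OF conjunct1[OF S']]
    obtain m where m: "m \<in> M" "1 - x * m \<in> M" using inverse_in_M[OF x(2)] by blast
    define w where "w = x * m"
    have "1 - w \<in> S" using m M_subset by (auto simp: w_def)
    then have wS: "w \<in> S" using S_closed(4)[OF S_closed(2), of "1 - w"] by simp
    have wM: "w \<notin> M" using M_closed(2)[of "1 - w" w] m one by (auto simp: w_def)
    have "z \<in> S'" for z
    proof -
      obtain k where k: "m ^ k * z \<in> S" using power_mult_mem[OF m(1)] by blast
      have "x ^ k * (m ^ k * z) \<in> S'"
        by (rule S'_closed(5)[OF S'_closed(6)[OF x(1)]]) (use k S' in blast)
      then have wz: "w ^ k * z \<in> S'" by (simp add: w_def power_mult_distrib mult_ac)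
      obtain r where r: "r \<in> S" "1 - r * w ^ k \<in> M"
        using residue_inverse[OF S_closed(7)[OF wS] prime_power[OF wS wM]] by blast
      define u where "u = 1 - r * w ^ k"
      obtain j where j: "u ^ j * z \<in> S" using power_mult_mem[of u] r by (auto simp: u_def)
      have "(\<Sum>i<j. u ^ i) \<in> S" using r M_subset by (intro S_closed) (auto simp: u_def)
      then have "(\<Sum>i<j. u ^ i) \<in> S'" "r \<in> S'" "u ^ j * z \<in> S'" using S' r(1) j by auto
      then have "r * (w ^ k * z) * (\<Sum>i<j. u ^ i) \<in> S'" by (intro S'_closed(5) wz)
      moreover have "r * (w ^ k * z) * (\<Sum>i<j. u ^ i) = (1 - u ^ j) * z"
      proof -
        have "1 - u ^ j = (1 - u) * (\<Sum>i<j. u ^ i)" by (rule one_diff_power_eq)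
        then show ?thesis by (simp add: u_def mult_ac)
      qed
      ultimately have "(1 - u ^ j) * z + u ^ j * z \<in> S'"
        using S'_closed(3) \<open>u ^ j * z \<in> S'\<close> by simp
      then show ?thesis by (simp add: algebra_simps)
    qed
    then show False using S' by auto
  qed
qed

text \<open>For \<open>x \<notin> Q\<close> some \<open>x * d\<close> is congruent to 1 modulo
  \<open>M\<close>. Were \<open>x\<close> in the conductor, \<open>y' * d * x\<close> would lie in
  \<open>S\<close>, and so \<open>x * d\<close> in \<open>M\<close>.\<close>

lemma conductor_S: "conductor S = Q"
proof (intro equalityI subsetI)
  fix x assume "x \<in> Q"
  then show "x \<in> conductor S" using Q_closed(3) Q_sub_S by (auto simp: conductor_def)
next
  fix x assume x: "x \<in> conductor S"
  show "x \<in> Q"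
  proof (rule ccontr)
    assume "x \<notin> Q"
    then obtain d where d: "1 - x * d \<in> M" using inverse_mod_M by blast
    have "(y' * d) * x \<in> S" using x by (auto simp: conductor_def)
    then have "y * ((y' * d) * x) \<in> M" using y by (intro M_closed)
    then have "x * d \<in> M" using y_power_cancel(1)[of 1 "d * x"] by (simp add: mult_ac)
    then show False using M_closed(2)[OF d] one by force
  qed
qed

end

text \<open>Inverses modulo \<open>I\<close> keep the elements of \<open>A - I\<close> out of any
  proper ideal above \<open>I\<close>. Hence exact values read off in \<open>(A, I)\<close> persist
  in the maximal pair, although Zorn's lemma gives no further control over it.\<close>

theorem maximal_subring_of_residue_field:
  fixes Q A I :: "'a::comm_ring_1 set"
  assumes Q: "prime_ideal Q" "Q \<subseteq> I" and A: "is_subring A" "I \<subseteq> A" "submod A I" "1 \<notin> I"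
    and residue: "\<And>a. a \<in> A \<Longrightarrow> a \<notin> I \<Longrightarrow> \<exists>r\<in>A. 1 - r * a \<in> I"
    and y: "y \<in> I" "y * y' = 1"
    and algebraic: "\<And>x. \<exists>p. (\<forall>i. coeff p i \<in> Q \<or> (\<exists>e. coeff p i * y' ^ e \<in> A - I)) \<and>
      (\<exists>i. coeff p i \<notin> Q) \<and> poly p x \<in> Q"
  shows "\<exists>S. maximal_subring S \<and> integrally_closed_in_ambient S \<and> conductor S = Q"
proof -
  obtain S M where SM: "maximal_pair S M" "A \<subseteq> S" "I \<subseteq> M"
    using maximal_pair_exists[OF A] by blast
  then interpret maximal_pair S M by simp
  have AM: "a \<notin> M" if a: "a \<in> A" "a \<notin> I" for a
  proof
    assume aM: "a \<in> M"
    obtain r where r: "r \<in> A" "1 - r * a \<in> I" using residue a by blast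
    then have "r * a \<in> M" using aM SM by (intro M_closed) auto
    then show False using M_closed(2)[of "1 - r * a" "r * a"] r SM one by auto
  qed
  interpret algebraic_pair S M Q y y'
  proof
    fix x
    obtain p where "\<forall>i. coeff p i \<in> Q \<or> (\<exists>e. coeff p i * y' ^ e \<in> A - I)"
      "\<exists>i. coeff p i \<notin> Q" "poly p x \<in> Q" using algebraic by blast
    then show "\<exists>p. (\<forall>i. coeff p i \<in> Q \<or> (\<exists>e. coeff p i * y' ^ e \<in> S - M)) \<and>
      (\<exists>i. coeff p i \<notin> Q) \<and> poly p x \<in> Q" using AM SM(2) by blast
  qed (use Q y SM in auto)
  show ?thesis
    using maximal_subring_S conductor_S integral_imp_mem
    by (auto simp: integrally_closed_in_ambient_def)
qed

section \<open>Growth of residue rings\<close>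

text \<open>Gaussian elimination without division, so that the solution stays in the subring
  \<open>E\<close>. An equation with a nonzero coefficient \<open>a j p\<close> eliminates the
  unknown \<open>p\<close>.\<close>

lemma homogeneous_system_solvable:
  fixes a :: "'j \<Rightarrow> 'i \<Rightarrow> 'k::idom"
  assumes "finite J" and E: "is_subring E"
  shows "finite I \<Longrightarrow> card J < card I \<Longrightarrow> (\<And>j i. j \<in> J \<Longrightarrow> i \<in> I \<Longrightarrow> a j i \<in> E) \<Longrightarrow>
    \<exists>c. (\<forall>i\<in>I. c i \<in> E) \<and> (\<exists>i\<in>I. c i \<noteq> 0) \<and> (\<forall>j\<in>J. (\<Sum>i\<in>I. c i * a j i) = 0)"
  using assms(1)
proof (induction J arbitrary: I a)
  case empty
  then have "I \<noteq> {}" by auto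
  then show ?case using is_subringD(2)[OF E] by (intro exI[of _ "\<lambda>_. 1"]) auto
next
  case (insert j J)
  show ?case
  proof (cases "\<forall>i\<in>I. a j i = 0")
    case True
    have "card J < card I" using insert by simp
    with insert.IH[of I a] insert.prems obtain c where
      "\<forall>i\<in>I. c i \<in> E" "\<exists>i\<in>I. c i \<noteq> 0" "\<forall>j\<in>J. (\<Sum>i\<in>I. c i * a j i) = 0" by blast
    with True show ?thesis by (intro exI[of _ c]) auto
  next
    case False
    then obtain p where p: "p \<in> I" "a j p \<noteq> 0" by blast
    define I' where "I' = I - {p}"
    define a' where "a' l i = a j p * a l i - a l p * a j i" for l i
    have I': "finite I'" "I = insert p I'" "p \<notin> I'" using p insert.prems by (auto simp: I'_def)
    have "a' l i \<in> E" if "l \<in> J" "i \<in> I'" for l i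
      unfolding a'_def by (intro is_subringD[OF E] insert.prems) (use that I' in auto)
    moreover have "card J < card I'" using insert I' by simp
    ultimately obtain c where c: "\<And>i. i \<in> I' \<Longrightarrow> c i \<in> E" "\<exists>i\<in>I'. c i \<noteq> 0"
      "\<And>l. l \<in> J \<Longrightarrow> (\<Sum>i\<in>I'. c i * a' l i) = 0"
      using insert.IH[of I' a'] I'(1) by blast
    define b where "b i = (if i = p then - (\<Sum>i\<in>I'. c i * a j i) else a j p * c i)" for i
    have sum_b: "(\<Sum>i\<in>I. b i * a l i) = (\<Sum>i\<in>I'. c i * (a j p * a l i - a l p * a j i))" for l
    proof -
      have "(\<Sum>i\<in>I. b i * a l i) = b p * a l p + (\<Sum>i\<in>I'. b i * a l i)" using I' by simp
      also have "(\<Sum>i\<in>I'. b i * a l i) = (\<Sum>i\<in>I'. a j p * c i * a l i)"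
        by (rule sum.cong) (use I' in \<open>auto simp: b_def\<close>)
      also have "b p * a l p = - (\<Sum>i\<in>I'. c i * (a l p * a j i))"
        by (simp add: b_def sum_distrib_left mult_ac)
      finally show ?thesis by (simp add: sum_subtractf algebra_simps)
    qed
    have "(\<Sum>i\<in>I. b i * a l i) = 0" if "l \<in> insert j J" for l
    proof (cases "l = j")
      case False
      then show ?thesis using that c(3)[of l] unfolding sum_b a'_def by simp
    qed (simp add: sum_b mult.commute)
    moreover have "\<forall>i\<in>I. b i \<in> E"
    proof
      fix i assume i: "i \<in> I"
      have "(\<Sum>i\<in>I'. c i * a j i) \<in> E"
        by (intro is_subring_sum[OF E] is_subringD[OF E] c insert.prems) (use I' in auto)
      moreover have "a j p * c i \<in> E" if "i \<noteq> p"
        by (intro is_subringD[OF E] c insert.prems) (use that i I' in auto)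
      ultimately show "b i \<in> E" using is_subring_uminus[OF E] by (auto simp: b_def)
    qed
    moreover have "\<exists>i\<in>I. b i \<noteq> 0"
      using c(2) p I' by (auto simp: b_def intro!: bexI)
    ultimately show ?thesis by (intro exI[of _ b]) blast
  qed
qed

lemma sum_lessThan_add: "(\<Sum>k<a + b. g k) = (\<Sum>k<a. g k) + (\<Sum>j<b. g (a + j))"
  for g :: "nat \<Rightarrow> 'a::comm_monoid_add"
  by (induction b) (simp_all add: add.assoc)

lemma sum_lessThan_mult: "(\<Sum>k<n * l. g k) = (\<Sum>i<n. \<Sum>j<l. g (i * l + j))"
  for g :: "nat \<Rightarrow> 'a::comm_monoid_add"
  by (induction n) (simp_all add: sum_lessThan_add add.commute[of l])

definition is_subfield :: "'k::field set \<Rightarrow> bool" where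
  "is_subfield E \<longleftrightarrow> is_subring E \<and> (\<forall>x\<in>E. inverse x \<in> E)"

definition algebraic_over :: "'k::comm_ring_1 set \<Rightarrow> 'k \<Rightarrow> bool" where
  "algebraic_over E a \<longleftrightarrow> (\<exists>q. q \<noteq> 0 \<and> (\<forall>i. coeff q i \<in> E) \<and> poly q a = 0)"

text \<open>Only an upper bound on the dimension is recorded: the spanning elements
  \<open>g i\<close> may lie outside \<open>F\<close>, and not every combination has to be in
  \<open>F\<close>.\<close>

definition finite_ext :: "'k::field set \<Rightarrow> 'k set \<Rightarrow> bool" where
  "finite_ext E F \<longleftrightarrow> is_subring F \<and> E \<subseteq> F \<and>
     (\<exists>n g. \<forall>x\<in>F. \<exists>e. (\<forall>i<n::nat. e i \<in> E) \<and> x = (\<Sum>i<n. e i * g i))"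

lemma finite_ext_self:
  assumes "is_subring E"
  shows "finite_ext E E"
  unfolding finite_ext_def
proof (intro conjI assms subset_refl)
  show "\<exists>n g. \<forall>x\<in>E. \<exists>e. (\<forall>i<n::nat. e i \<in> E) \<and> x = (\<Sum>i<n. e i * g i)"
    by (rule exI[of _ "Suc 0"], rule exI[of _ "\<lambda>_. 1"]) auto
qed

text \<open>\<open>F[a]\<close> is spanned over \<open>E\<close> by the products
  \<open>a ^ i * g j\<close> with \<open>i\<close> below the degree of a monic equation for
  \<open>a\<close>. The index \<open>k\<close> codes \<open>i = k div n\<close> and
  \<open>j = k mod n\<close>.\<close>

lemma finite_ext_adjoin:
  assumes E: "is_subfield E" and F: "finite_ext E F" and a: "algebraic_over E a"
  obtains F' where "finite_ext E F'" "insert a F \<subseteq> F'"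
proof -
  have F': "is_subring F" "E \<subseteq> F" using F by (auto simp: finite_ext_def)
  obtain n g where g: "\<And>x. x \<in> F \<Longrightarrow> \<exists>e. (\<forall>i<n::nat. e i \<in> E) \<and> x = (\<Sum>i<n. e i * g i)"
    using F unfolding finite_ext_def by blast
  obtain q where q: "q \<noteq> 0" "\<And>i. coeff q i \<in> E" "poly q a = 0"
    using a by (auto simp: algebraic_over_def)
  define q' where "q' = smult (inverse (lead_coeff q)) q"
  have q': "lead_coeff q' = 1" "\<And>i. coeff q' i \<in> F" "poly q' a = 0"
  proof -
    show "lead_coeff q' = 1" "poly q' a = 0" using q by (simp_all add: q'_def)
    show "coeff q' i \<in> F" for i
      using q(2) E F'(2) unfolding q'_def coeff_smult is_subfield_def
      by (intro subsetD[OF F'(2)] is_subringD(5)) auto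
  qed
  define V where "V = {poly p a | p. \<forall>i. coeff p i \<in> F}"
  note V = subring_poly_values[OF F'(1), of a, folded V_def]
  have "\<exists>e. (\<forall>k<degree q' * n. e k \<in> E) \<and> x = (\<Sum>k<degree q' * n. e k * (a ^ (k div n) * g (k mod n)))"
    if xV: "x \<in> V" for x
  proof -
    obtain p where p: "\<forall>i. coeff p i \<in> F" "x = poly p a" using xV unfolding V_def by blast
    then obtain r where r: "\<And>i. coeff r i \<in> F" "\<And>i. i \<ge> degree q' \<Longrightarrow> coeff r i = 0" "poly r a = x"
      using reduce_mod_monic[OF F'(1) submod_self[OF F'(1)] q', of p] by auto
    obtain e where e: "\<And>i j. j < n \<Longrightarrow> e i j \<in> E" "\<And>i. coeff r i = (\<Sum>j<n. e i j * g j)"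
      using g[OF r(1)] by metis
    have "x = (\<Sum>i<degree q'. coeff r i * a ^ i)"
      using poly_eq_sum_lessThan[of "degree q'" r a] r by simp
    also have "\<dots> = (\<Sum>i<degree q'. \<Sum>j<n. e i j * (a ^ i * g j))"
      unfolding e(2) sum_distrib_right by (intro sum.cong refl) (simp add: mult_ac)
    also have "\<dots> = (\<Sum>k<degree q' * n. e (k div n) (k mod n) * (a ^ (k div n) * g (k mod n)))"
      unfolding sum_lessThan_mult by (intro sum.cong) auto
    finally have "x = (\<Sum>k<degree q' * n. e (k div n) (k mod n) * (a ^ (k div n) * g (k mod n)))" .
    moreover have "e (k div n) (k mod n) \<in> E" if "k < degree q' * n" for k
      using that by (intro e(1)) (cases "n = 0", auto)
    ultimately show ?thesis by (intro exI[of _ "\<lambda>k. e (k div n) (k mod n)"]) auto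
  qed
  then have "\<exists>n g. \<forall>x\<in>V. \<exists>e. (\<forall>i<n::nat. e i \<in> E) \<and> x = (\<Sum>i<n. e i * g i)"
    by (intro exI[of _ "degree q' * n"] exI[of _ "\<lambda>k. a ^ (k div n) * g (k mod n)"]) (rule ballI)
  then have "finite_ext E V"
    unfolding finite_ext_def using V F'(2) by blast
  then show thesis using that[of V] V by auto
qed

lemma finite_ext_adjoin_finite:
  assumes E: "is_subfield E" and F: "finite_ext E F" and "finite X" "\<forall>a\<in>X. algebraic_over E a"
  shows "\<exists>F'. finite_ext E F' \<and> X \<union> F \<subseteq> F'"
  using assms(3,4)
proof (induction X)
  case empty
  then show ?case using F by auto
next
  case (insert a X)
  then obtain F' where F': "finite_ext E F'" "X \<union> F \<subseteq> F'" by auto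
  with insert.prems obtain F'' where "finite_ext E F''" "insert a F' \<subseteq> F''"
    using finite_ext_adjoin[OF E F'(1), of a] by auto
  with F'(2) show ?case by auto
qed

section \<open>Polynomials with coefficients in a subring and bounded exponents\<close>

abbreviation const :: "'k \<Rightarrow> ('v \<Rightarrow>\<^sub>0 nat) \<Rightarrow>\<^sub>0 'k::zero" where
  "const \<equiv> Poly_Mapping.single 0"

lemma lookup_const_mult: "Poly_Mapping.lookup (const c * f) m = c * Poly_Mapping.lookup f m"
  for f :: "('v \<Rightarrow>\<^sub>0 nat) \<Rightarrow>\<^sub>0 'k::comm_ring_1"
  unfolding mult_map_scale_conv_mult[symmetric] by (simp add: Poly_Mapping.map.rep_eq when_def)

text \<open>The bound is on each exponent separately: the monomials form a cube with
  \<open>(d + 1) ^ CARD('v)\<close> points, and bounds add under multiplication.\<close>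

definition box :: "'k::comm_ring_1 set \<Rightarrow> nat \<Rightarrow> (('v \<Rightarrow>\<^sub>0 nat) \<Rightarrow>\<^sub>0 'k) set" where
  "box F d = {f. \<forall>m\<in>Poly_Mapping.keys f. Poly_Mapping.lookup f m \<in> F \<and> (\<forall>i. Poly_Mapping.lookup m i \<le> d)}"

lemma box_lookup: "is_subring F \<Longrightarrow> f \<in> box F d \<Longrightarrow> Poly_Mapping.lookup f m \<in> F"
  using is_subringD(1)[of F] by (cases "m \<in> Poly_Mapping.keys f") (auto simp: box_def in_keys_iff)

lemma box_mono: "F \<subseteq> F' \<Longrightarrow> d \<le> d' \<Longrightarrow> box F d \<subseteq> box F' d'"
  unfolding box_def by (fastforce intro: order_trans)

lemma box_zero: "0 \<in> box F d" by (simp add: box_def)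

lemma box_add:
  assumes F: "is_subring F" and "f \<in> box F d" "g \<in> box F d"
  shows "f + g \<in> box F d"
proof -
  have "Poly_Mapping.lookup (f + g) m \<in> F" for m
    unfolding lookup_add by (intro is_subringD(3)[OF F] box_lookup[OF F assms(2)] box_lookup[OF F assms(3)])
  then show ?thesis using assms keys_add[of f g] unfolding box_def by blast
qed

lemma box_sum: "is_subring F \<Longrightarrow> (\<And>i. i \<in> I \<Longrightarrow> f i \<in> box F d) \<Longrightarrow> sum f I \<in> box F d"
  by (induction I rule: infinite_finite_induct) (auto simp: box_zero box_add)

lemma poly_mapping_eq_sum_single: "f = (\<Sum>m\<in>Poly_Mapping.keys f. Poly_Mapping.single m (Poly_Mapping.lookup f m))"
proof (rule poly_mapping_eqI)
  fix k
  have "Poly_Mapping.lookup (\<Sum>m\<in>Poly_Mapping.keys f. Poly_Mapping.single m (Poly_Mapping.lookup f m)) k =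
    (\<Sum>m\<in>Poly_Mapping.keys f. if m = k then Poly_Mapping.lookup f m else 0)"
    unfolding lookup_sum by (rule sum.cong) (auto simp: lookup_single when_def)
  then show "Poly_Mapping.lookup f k = Poly_Mapping.lookup (\<Sum>m\<in>Poly_Mapping.keys f. Poly_Mapping.single m (Poly_Mapping.lookup f m)) k"
    by (simp add: in_keys_iff)
qed

lemma box_mult:
  assumes F: "is_subring F" and f: "f \<in> box F d" and g: "g \<in> box F d'"
  shows "f * g \<in> box F (d + d')"
proof -
  have "f * g = (\<Sum>m\<in>Poly_Mapping.keys f. \<Sum>m'\<in>Poly_Mapping.keys g. Poly_Mapping.single (m + m') (Poly_Mapping.lookup f m * Poly_Mapping.lookup g m'))"
    by (subst (1) poly_mapping_eq_sum_single[of f], subst (1) poly_mapping_eq_sum_single[of g])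
      (simp add: sum_product mult_single)
  moreover have "Poly_Mapping.single (m + m') (Poly_Mapping.lookup f m * Poly_Mapping.lookup g m') \<in> box F (d + d')"
    if "m \<in> Poly_Mapping.keys f" "m' \<in> Poly_Mapping.keys g" for m m'
    using that f g is_subringD(5)[OF F] by (auto simp: box_def lookup_add intro: add_mono)
  ultimately show ?thesis by (auto intro!: box_sum[OF F])
qed

lemma box_one: "is_subring F \<Longrightarrow> 1 \<in> box F d"
  by (simp add: box_def is_subringD)

lemma box_power:
  assumes F: "is_subring F" and "f \<in> box F d"
  shows "f ^ n \<in> box F (n * d)"
  by (induction n) (auto simp: box_one[OF F] box_mult[OF F] assms)

text \<open>The exponent bound is fixed before the coefficient ring, which is chosen later as a
  finite extension containing the coefficients of \<open>f\<close>.\<close>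

lemma box_exists:
  fixes f :: "('v::finite \<Rightarrow>\<^sub>0 nat) \<Rightarrow>\<^sub>0 'k::comm_ring_1"
  obtains d where "\<And>F. Poly_Mapping.lookup f ` Poly_Mapping.keys f \<subseteq> F \<Longrightarrow> f \<in> box F d"
proof -
  define X where "X = (\<lambda>(m, i). Poly_Mapping.lookup m i) ` (Poly_Mapping.keys f \<times> (UNIV :: 'v set))"
  have "Poly_Mapping.lookup m i \<le> Max X" if "m \<in> Poly_Mapping.keys f" for m i
    by (rule Max_ge) (use that in \<open>auto simp: X_def\<close>)
  then show thesis using that[of "Max X"] by (auto simp: box_def)
qed

lemma finite_exponents: "finite {m :: 'v::finite \<Rightarrow>\<^sub>0 nat. \<forall>i. Poly_Mapping.lookup m i \<le> d}" (is "finite ?B")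
  and card_exponents: "card {m :: 'v::finite \<Rightarrow>\<^sub>0 nat. \<forall>i. Poly_Mapping.lookup m i \<le> d} \<le> (d + 1) ^ CARD('v)"
proof -
  have sub: "Poly_Mapping.lookup ` ?B \<subseteq> PiE (UNIV :: 'v set) (\<lambda>_. {..d})" by (auto simp: PiE_def)
  have fin: "finite (PiE (UNIV :: 'v set) (\<lambda>_. {..d}))" by (intro finite_PiE) auto
  have inj: "inj_on Poly_Mapping.lookup ?B" by (auto intro: inj_onI poly_mapping_eqI)
  show "finite ?B" using finite_imageD[OF finite_subset[OF sub fin] inj] .
  have "card ?B = card (Poly_Mapping.lookup ` ?B)" by (rule card_image[OF inj, symmetric])
  also have "\<dots> \<le> card (PiE (UNIV :: 'v set) (\<lambda>_. {..d}))" by (rule card_mono[OF fin sub])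
  also have "\<dots> = (d + 1) ^ CARD('v)" by (subst card_PiE) auto
  finally show "card ?B \<le> (d + 1) ^ CARD('v)" .
qed

section \<open>Growth of the polynomial ring modulo prime ideals\<close>

definition free_mod ::
  "'k::comm_ring_1 set \<Rightarrow> (('v \<Rightarrow>\<^sub>0 nat) \<Rightarrow>\<^sub>0 'k) set \<Rightarrow> nat \<Rightarrow> (nat \<Rightarrow> ('v \<Rightarrow>\<^sub>0 nat) \<Rightarrow>\<^sub>0 'k) \<Rightarrow> bool"
  where "free_mod E P n f \<longleftrightarrow>
    (\<forall>c. (\<forall>i<n. c i \<in> E) \<and> (\<Sum>i<n. const (c i) * f i) \<in> P \<longrightarrow> (\<forall>i<n. c i = 0))"

text \<open>A substitute for "the transcendence degree of \<open>T/P\<close> is at least \<open>m\<close>".\<close>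

definition growth :: "'k::field set \<Rightarrow> (('v \<Rightarrow>\<^sub>0 nat) \<Rightarrow>\<^sub>0 'k) set \<Rightarrow> nat \<Rightarrow> bool" where
  "growth E P m \<longleftrightarrow> (\<exists>F d. finite_ext E F \<and>
     (\<forall>N. \<exists>f. (\<forall>i<(N + 1) ^ m. f i \<in> box F (d * N)) \<and> free_mod E P ((N + 1) ^ m) f))"

text \<open>Monomials times the \<open>g j\<close> span \<open>box F d\<close> over
  \<open>E\<close>. With more elements than that, comparing coefficients gives more unknowns than
  equations, and the resulting relation is already an identity between polynomials.\<close>

lemma free_mod_bound:
  fixes P :: "(('v::finite \<Rightarrow>\<^sub>0 nat) \<Rightarrow>\<^sub>0 'k::field) set"
  assumes E: "is_subring E" and F: "is_subring F"
    and g: "\<And>x. x \<in> F \<Longrightarrow> \<exists>e. (\<forall>j<n::nat. e j \<in> E) \<and> x = (\<Sum>j<n. e j * g j)"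
    and P: "0 \<in> P" and f: "\<And>i. i < l \<Longrightarrow> f i \<in> box F d" and free: "free_mod E P l f"
  shows "l \<le> (d + 1) ^ CARD('v) * n"
proof (rule ccontr)
  assume "\<not> l \<le> (d + 1) ^ CARD('v) * n"
  define B where "B = {m :: 'v \<Rightarrow>\<^sub>0 nat. \<forall>i. Poly_Mapping.lookup m i \<le> d}"
  have "card (B \<times> {..<n}) \<le> (d + 1) ^ CARD('v) * n"
    using card_exponents[of d, where 'v='v] by (simp add: card_cartesian_product B_def)
  then have card: "card (B \<times> {..<n}) < card {..<l}" using \<open>\<not> l \<le> _\<close> by simp
  have fin: "finite (B \<times> {..<n})" using finite_exponents[of d, where 'v='v] by (simp add: B_def)
  have "\<forall>i m. \<exists>e. i < l \<longrightarrow> (\<forall>j<n. e j \<in> E) \<and> Poly_Mapping.lookup (f i) m = (\<Sum>j<n. e j * g j)"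
    using g[OF box_lookup[OF F f]] by blast
  then obtain e where e: "\<And>i m. i < l \<Longrightarrow> (\<forall>j<n. e i m j \<in> E) \<and> Poly_Mapping.lookup (f i) m = (\<Sum>j<n. e i m j * g j)"
    by metis
  have "\<exists>c. (\<forall>i\<in>{..<l}. c i \<in> E) \<and> (\<exists>i\<in>{..<l}. c i \<noteq> 0) \<and>
    (\<forall>mj\<in>B \<times> {..<n}. (\<Sum>i\<in>{..<l}. c i * e i (fst mj) (snd mj)) = 0)"
    using e by (intro homogeneous_system_solvable[OF fin E _ card]) auto
  then obtain c where c: "\<And>i. i < l \<Longrightarrow> c i \<in> E" "\<exists>i<l. c i \<noteq> 0"
    "\<And>m j. m \<in> B \<Longrightarrow> j < n \<Longrightarrow> (\<Sum>i<l. c i * e i m j) = 0" by force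
  have "(\<Sum>i<l. const (c i) * f i) = 0"
  proof (rule poly_mapping_eqI)
    fix m
    have "(\<Sum>i<l. c i * Poly_Mapping.lookup (f i) m) = 0"
    proof (cases "m \<in> B")
      case True
      have "(\<Sum>i<l. c i * Poly_Mapping.lookup (f i) m) = (\<Sum>i<l. \<Sum>j<n. c i * e i m j * g j)"
        using e by (intro sum.cong) (auto simp: sum_distrib_left mult_ac)
      also have "\<dots> = (\<Sum>j<n. \<Sum>i<l. c i * e i m j * g j)" by (rule sum.swap)
      also have "\<dots> = (\<Sum>j<n. (\<Sum>i<l. c i * e i m j) * g j)" by (simp add: sum_distrib_right)
      also have "\<dots> = 0" using c(3)[OF True] by simp
      finally show ?thesis .
    next
      case False
      have "Poly_Mapping.lookup (f i) m = 0" if "i < l" for i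
        using f[OF that] False by (force simp: box_def B_def in_keys_iff)
      then show ?thesis by simp
    qed
    then show "Poly_Mapping.lookup (\<Sum>i<l. const (c i) * f i) m = Poly_Mapping.lookup 0 m"
      by (simp add: lookup_sum lookup_const_mult)
  qed
  then show False using free P c unfolding free_mod_def by auto
qed

lemma growth_le_card:
  fixes P :: "(('v::finite \<Rightarrow>\<^sub>0 nat) \<Rightarrow>\<^sub>0 'k::field) set"
  assumes E: "is_subring E" and P: "0 \<in> P" and growth: "growth E P m"
  shows "m \<le> CARD('v)"
proof (rule ccontr)
  assume m: "\<not> m \<le> CARD('v)"
  obtain F d where F: "finite_ext E F" and f: "\<And>N. \<exists>f. (\<forall>i<(N + 1) ^ m. f i \<in> box F (d * N)) \<and>
      free_mod E P ((N + 1) ^ m) f"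
    using growth unfolding growth_def by blast
  obtain n g where g: "\<And>x. x \<in> F \<Longrightarrow> \<exists>e. (\<forall>j<n::nat. e j \<in> E) \<and> x = (\<Sum>j<n. e j * g j)"
    using F unfolding finite_ext_def by blast
  have F': "is_subring F" using F by (simp add: finite_ext_def)
  \<comment> \<open>Chosen so that the constant \<open>n * (d + 1) ^ CARD('v)\<close> of the upper
    bound is just below the additional factor \<open>N + 1\<close> of the lower bound.\<close>
  define N where "N = n * (d + 1) ^ CARD('v)"
  obtain f where "\<forall>i<(N + 1) ^ m. f i \<in> box F (d * N)" "free_mod E P ((N + 1) ^ m) f"
    using f[of N] by blast
  then have "(N + 1) ^ m \<le> (d * N + 1) ^ CARD('v) * n"
    using free_mod_bound[OF E F' g P] by blast
  also have "\<dots> \<le> ((d + 1) * (N + 1)) ^ CARD('v) * n"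
    by (intro mult_right_mono power_mono) auto
  also have "\<dots> = N * (N + 1) ^ CARD('v)"
    unfolding power_mult_distrib by (subst (2) N_def) (simp only: mult_ac)
  also have "\<dots> < (N + 1) ^ Suc CARD('v)" by simp
  also have "\<dots> \<le> (N + 1) ^ m" using m by (intro power_increasing) auto
  finally show False by simp
qed

text \<open>Modulo \<open>P'\<close> only the layer \<open>i = 0\<close> survives, so its
  coefficients vanish by independence. What remains is divisible by \<open>p\<close>, which cancels
  because \<open>P\<close> is prime.\<close>

lemma free_mod_powers:
  fixes P P' :: "(('v \<Rightarrow>\<^sub>0 nat) \<Rightarrow>\<^sub>0 'k::field) set"
  assumes P: "prime_ideal P" and P': "is_ideal P'" "P \<subseteq> P'" and p: "p \<in> P'" "p \<notin> P"
    and free: "free_mod E P' l f"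
  shows "(\<And>i j. i < n \<Longrightarrow> j < l \<Longrightarrow> c i j \<in> E) \<Longrightarrow> (\<Sum>i<n. p ^ i * (\<Sum>j<l. const (c i j) * f j)) \<in> P \<Longrightarrow>
    i < n \<Longrightarrow> j < l \<Longrightarrow> c i j = 0"
proof (induction n arbitrary: c i)
  case (Suc n)
  have P'c: "submod UNIV P'" using P' by (simp add: submod_UNIV)
  define S0 where "S0 = (\<Sum>j<l. const (c 0 j) * f j)"
  define R where "R = (\<Sum>i<n. p ^ i * (\<Sum>j<l. const (c (Suc i) j) * f j))"
  have eq: "(\<Sum>i<Suc n. p ^ i * (\<Sum>j<l. const (c i j) * f j)) = S0 + p * R"
    unfolding sum.lessThan_Suc_shift by (simp add: S0_def R_def sum_distrib_left mult_ac)
  then have "S0 + p * R \<in> P" using Suc.prems(2) by simp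
  then have "(S0 + p * R) - p * R \<in> P'"
    using p(1) P'(2) by (intro submod_diff[OF is_subring_UNIV P'c] submodD(4)[OF P'c]) auto
  then have "S0 \<in> P'" by simp
  then have c0: "c 0 j = 0" if "j < l" for j
    using free that Suc.prems(1) unfolding free_mod_def S0_def by blast
  then have "S0 = 0" by (simp add: S0_def)
  then have "p * R \<in> P" using \<open>S0 + p * R \<in> P\<close> by simp
  then have "R \<in> P" using P p(2) by (auto simp: prime_ideal_def)
  then show ?case
    using Suc.IH[of "\<lambda>i. c (Suc i)" "i - 1"] Suc.prems c0 unfolding R_def by (cases i) auto
qed auto

text \<open>For \<open>p\<close> in \<open>P'\<close> but not in \<open>P\<close>, the products
  \<open>p ^ i * f j\<close> with \<open>i \<le> N\<close> multiply the count by
  \<open>N + 1\<close> and raise the exponent bound only by \<open>\<delta> * N\<close>. The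
  coefficients of \<open>p\<close> enlarge the finite extension once, for all
  \<open>N\<close>.\<close>

lemma growth_step:
  fixes P P' :: "(('v::finite \<Rightarrow>\<^sub>0 nat) \<Rightarrow>\<^sub>0 'k::field) set"
  assumes E: "is_subfield E" "\<And>a. algebraic_over E a"
    and P: "prime_ideal P" and P': "is_ideal P'" "P \<subset> P'" and growth: "growth E P' m"
  shows "growth E P (Suc m)"
proof -
  obtain p where p: "p \<in> P'" "p \<notin> P" using P'(2) by blast
  obtain F d where F: "finite_ext E F" and f: "\<And>N. \<exists>f. (\<forall>i<(N + 1) ^ m. f i \<in> box F (d * N)) \<and>
      free_mod E P' ((N + 1) ^ m) f"
    using growth unfolding growth_def by blast
  obtain \<delta> where \<delta>: "\<And>F. Poly_Mapping.lookup p ` Poly_Mapping.keys p \<subseteq> F \<Longrightarrow> p \<in> box F \<delta>" using box_exists[of p] by blast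
  obtain F' where F': "finite_ext E F'" "Poly_Mapping.lookup p ` Poly_Mapping.keys p \<union> F \<subseteq> F'"
    using finite_ext_adjoin_finite[OF E(1) F, of "Poly_Mapping.lookup p ` Poly_Mapping.keys p"] E(2) by auto
  have subr: "is_subring F'" using F' by (simp add: finite_ext_def)
  have pF': "p \<in> box F' \<delta>" using F' by (intro \<delta>) auto
  have "\<exists>f. (\<forall>i<(N + 1) ^ Suc m. f i \<in> box F' ((\<delta> + d) * N)) \<and> free_mod E P ((N + 1) ^ Suc m) f" for N
  proof -
    define l where "l = (N + 1) ^ m"
    have l: "l > 0" by (simp add: l_def)
    obtain f where f: "\<And>i. i < l \<Longrightarrow> f i \<in> box F (d * N)" "free_mod E P' l f"
      using f[of N] unfolding l_def by blast
    define h where "h k = p ^ (k div l) * f (k mod l)" for k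
    have "h k \<in> box F' ((\<delta> + d) * N)" if "k < (N + 1) * l" for k
    proof -
      have "k div l < N + 1" using that by (simp add: less_mult_imp_div_less)
      then have "p ^ (k div l) \<in> box F' (\<delta> * N)"
        using box_power[OF subr pF', of "k div l"] box_mono[of F' F' "(k div l) * \<delta>" "\<delta> * N"]
        by (auto simp: mult.commute)
      moreover have "f (k mod l) \<in> box F' (d * N)"
        using f(1)[of "k mod l"] l box_mono[of F F' "d * N" "d * N"] F'(2) by auto
      ultimately show ?thesis
        unfolding h_def by (simp add: add_mult_distrib box_mult[OF subr])
    qed
    moreover have "free_mod E P ((N + 1) * l) h"
      unfolding free_mod_def
    proof (intro allI impI, elim conjE)
      fix c k assume c: "\<forall>i<(N + 1) * l. c i \<in> E" "(\<Sum>i<(N + 1) * l. const (c i) * h i) \<in> P"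
        and k: "k < (N + 1) * l"
      define c' where "c' i j = c (i * l + j)" for i j
      have idx: "i * l + j < (N + 1) * l" if "i < N + 1" "j < l" for i j
      proof -
        have "i * l + j < (i + 1) * l" using that by simp
        also have "\<dots> \<le> (N + 1) * l" using that by (intro mult_right_mono) auto
        finally show ?thesis .
      qed
      have "(\<Sum>i<(N + 1) * l. const (c i) * h i) = (\<Sum>i<N + 1. p ^ i * (\<Sum>j<l. const (c' i j) * f j))"
        unfolding sum_lessThan_mult sum_distrib_left
        by (intro sum.cong) (auto simp: h_def c'_def mult_ac)
      then have "(\<Sum>i<N + 1. p ^ i * (\<Sum>j<l. const (c' i j) * f j)) \<in> P" using c(2) by simp
      moreover have "k div l < N + 1" using k by (simp add: less_mult_imp_div_less)
      moreover have "c' i j \<in> E" if "i < N + 1" "j < l" for i j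
        unfolding c'_def using c(1) idx[OF that] by blast
      ultimately have "c' (k div l) (k mod l) = 0"
        using P'(2) l by (intro free_mod_powers[OF P P'(1) _ p f(2), where n = "N + 1" and c = c']) auto
      then show "c k = 0" by (simp add: c'_def)
    qed
    moreover have "(N + 1) ^ Suc m = (N + 1) * l" by (simp add: l_def)
    ultimately show ?thesis by metis
  qed
  then show ?thesis unfolding growth_def using F'(1) by blast
qed

lemma growth_chain:
  fixes f :: "nat \<Rightarrow> (('v::finite \<Rightarrow>\<^sub>0 nat) \<Rightarrow>\<^sub>0 'k::field) set"
  assumes E: "is_subfield E" "\<And>a. algebraic_over E a"
  shows "(\<forall>i\<le>k. prime_ideal (f i)) \<Longrightarrow> (\<forall>i<k. f i \<subset> f (Suc i)) \<Longrightarrow> growth E (f k) m \<Longrightarrow>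
    growth E (f 0) (k + m)"
proof (induction k arbitrary: m)
  case (Suc k)
  have "growth E (f k) (Suc m)"
    by (rule growth_step[OF E, where P' = "f (Suc k)"]) (use Suc.prems in \<open>auto simp: prime_ideal_def\<close>)
  then show ?case using Suc.IH[of "Suc m"] Suc.prems by simp
qed simp

text \<open>For infinite height no chain attains the supremum; a chain longer than
  \<open>h - 1\<close> suffices. The case \<open>h = 0\<close> is served by the trivial
  chain.\<close>

lemma height_chain:
  fixes Q :: "'a::comm_ring_1 set"
  assumes "prime_ideal Q" "enat h \<le> height Q"
  obtains k f where "h \<le> k" "\<forall>i\<le>k. prime_ideal (f i)" "\<forall>i<k. f i \<subset> f (Suc i)" "f k = Q"
proof (cases h)
  case 0
  then show thesis using that[of 0 "\<lambda>_. Q"] assms by auto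
next
  case (Suc h')
  then have "enat h' < height Q" using assms(2) by (metis enat_ord_simps(2) lessI order_less_le_trans)
  then obtain k where k: "enat h' < enat k" "\<exists>f :: nat \<Rightarrow> 'a set.
      (\<forall>i\<le>k. prime_ideal (f i)) \<and> (\<forall>i<k. f i \<subset> f (Suc i)) \<and> f k = Q"
    unfolding height_def less_Sup_iff by blast
  then have "h \<le> k" using Suc by simp
  then show thesis using that k(2) by blast
qed

text \<open>If the monomials \<open>x ^ i * t ^ j\<close> were independent, \<open>T/Q\<close> would
  have growth 2, and a chain of at least \<open>CARD('v) - 1\<close> steps below \<open>Q\<close>
  would lift this past the bound \<open>CARD('v)\<close>. The relation has coefficients in
  \<open>E\<close> because growth is measured over \<open>E\<close>.\<close>

lemma dependent_mod:
  fixes Q :: "(('v::finite \<Rightarrow>\<^sub>0 nat) \<Rightarrow>\<^sub>0 'k::field) set"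
  assumes E: "is_subfield E" "\<And>a. algebraic_over E a"
    and Q: "prime_ideal Q" "enat (CARD('v) - 1) \<le> height Q"
  shows "\<exists>N c. (\<forall>i<N. \<forall>j<N. c i j \<in> E) \<and> (\<exists>i<N. \<exists>j<N. c i j \<noteq> 0) \<and>
    (\<Sum>i<N. \<Sum>j<N. const (c i j) * (x ^ i * t ^ j)) \<in> Q"
proof (rule ccontr)
  assume neg: "\<not> ?thesis"
  have indep: "c i j = 0" if "\<forall>i<N. \<forall>j<N. c i j \<in> E" "i < N" "j < N"
    "(\<Sum>i<N. \<Sum>j<N. const (c i j) * (x ^ i * t ^ j)) \<in> Q" for N c i j
    using neg[unfolded not_ex, rule_format, of N c] that by blast
  have subr: "is_subring E" using E by (simp add: is_subfield_def)
  obtain d1 where d1: "\<And>F. Poly_Mapping.lookup x ` Poly_Mapping.keys x \<subseteq> F \<Longrightarrow> x \<in> box F d1" using box_exists[of x] by blast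
  obtain d2 where d2: "\<And>F. Poly_Mapping.lookup t ` Poly_Mapping.keys t \<subseteq> F \<Longrightarrow> t \<in> box F d2" using box_exists[of t] by blast
  obtain F where F: "finite_ext E F" "Poly_Mapping.lookup x ` Poly_Mapping.keys x \<union> Poly_Mapping.lookup t ` Poly_Mapping.keys t \<subseteq> F"
    using finite_ext_adjoin_finite[OF E(1) finite_ext_self[OF subr], of "Poly_Mapping.lookup x ` Poly_Mapping.keys x \<union> Poly_Mapping.lookup t ` Poly_Mapping.keys t"] E(2)
    by auto
  have subF: "is_subring F" using F by (simp add: finite_ext_def)
  have xt: "x \<in> box F d1" "t \<in> box F d2" using F(2) by (auto intro!: d1 d2)
  have "growth E Q 2"
    unfolding growth_def
  proof (intro exI[of _ F] exI[of _ "d1 + d2"] conjI F(1) allI)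
    fix N :: nat
    define l :: nat where "l = N + 1"
    define h where "h k = x ^ (k div l) * t ^ (k mod l)" for k
    have "h k \<in> box F ((d1 + d2) * N)" if "k < l * l" for k
    proof -
      have "k div l \<le> N" using that less_mult_imp_div_less[of k l l] by (simp add: l_def)
      moreover have "k mod l \<le> N" by (simp add: l_def flip: less_Suc_eq_le)
      ultimately have "x ^ (k div l) \<in> box F (d1 * N)" "t ^ (k mod l) \<in> box F (d2 * N)"
        using box_power[OF subF xt(1), of "k div l"] box_power[OF subF xt(2), of "k mod l"]
          box_mono[of F F "(k div l) * d1" "d1 * N"] box_mono[of F F "(k mod l) * d2" "d2 * N"]
        by (auto simp: mult.commute)
      then show ?thesis unfolding h_def by (simp add: add_mult_distrib box_mult[OF subF])
    qed
    moreover have "free_mod E Q (l * l) h"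
      unfolding free_mod_def
    proof (intro allI impI, elim conjE)
      fix c k assume c: "\<forall>i<l * l. c i \<in> E" "(\<Sum>i<l * l. const (c i) * h i) \<in> Q" and k: "k < l * l"
      have idx: "i * l + j < l * l" if "i < l" "j < l" for i j
      proof -
        have "i * l + j < (i + 1) * l" using that by simp
        also have "\<dots> \<le> l * l" using that by (intro mult_right_mono) auto
        finally show ?thesis .
      qed
      have "(\<Sum>i<l * l. const (c i) * h i) = (\<Sum>i<l. \<Sum>j<l. const (c (i * l + j)) * (x ^ i * t ^ j))"
        unfolding sum_lessThan_mult by (intro sum.cong) (auto simp: h_def)
      then have "(\<Sum>i<l. \<Sum>j<l. const (c (i * l + j)) * (x ^ i * t ^ j)) \<in> Q" using c(2) by simp
      moreover have "\<forall>i<l. \<forall>j<l. c (i * l + j) \<in> E" using c(1) idx by blast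
      moreover have "k div l < l" "k mod l < l" using k less_mult_imp_div_less[of k l l] by (auto simp: l_def)
      ultimately have "c ((k div l) * l + k mod l) = 0"
        using indep[of l "\<lambda>i j. c (i * l + j)" "k div l" "k mod l"] by simp
      then show "c k = 0" by simp
    qed
    moreover have "(N + 1) ^ 2 = l * l" by (simp add: l_def power2_eq_square)
    ultimately show "\<exists>f. (\<forall>i<(N + 1) ^ 2. f i \<in> box F ((d1 + d2) * N)) \<and> free_mod E Q ((N + 1) ^ 2) f"
      by metis
  qed
  moreover obtain k f where k: "CARD('v) - 1 \<le> k" "\<forall>i\<le>k. prime_ideal (f i)" "\<forall>i<k. f i \<subset> f (Suc i)" "f k = Q"
    using height_chain[OF Q] by blast
  ultimately have "growth E (f 0) (k + 2)" using growth_chain[OF E k(2,3), of 2] by (simp only:)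
  moreover have "0 \<in> f 0" using k(2) by (auto simp: prime_ideal_def is_ideal_def)
  ultimately have "k + 2 \<le> CARD('v)" using growth_le_card[OF subr] by blast
  then show False using k(1) by simp
qed

section \<open>Valuations from Liouville series\<close>

text \<open>What \<open>\<int>\<close> with \<open>y = 2\<close> and \<open>L[y]\<close> have in
  common. \<open>size\<close> acts as an archimedean absolute value, \<open>size_power\<close> says
  that nonzero multiples of \<open>y ^ e\<close> are large, and \<open>residue\<close> makes the
  nonzero classes of \<open>B\<close> modulo \<open>y\<close> invertible.\<close>

locale sized_ring =
  fixes B :: "'k::field set" and y :: 'k and size :: "'k \<Rightarrow> nat"
  assumes B: "is_subring B" and y: "y \<in> B" "y \<noteq> 0"
    and size_add: "\<And>a b. a \<in> B \<Longrightarrow> b \<in> B \<Longrightarrow> size (a + b) \<le> size a + size b"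
    and size_diff: "\<And>a b. a \<in> B \<Longrightarrow> b \<in> B \<Longrightarrow> size (a - b) \<le> size a + size b"
    and size_mult: "\<And>a b. a \<in> B \<Longrightarrow> b \<in> B \<Longrightarrow> size (a * b) \<le> size a * size b"
    and size_power: "\<And>c e. c \<in> B \<Longrightarrow> c \<noteq> 0 \<Longrightarrow> 2 ^ e \<le> size (y ^ e * c)"
    and residue: "\<And>b. b \<in> B \<Longrightarrow> b \<notin> (*) y ` B \<Longrightarrow> \<exists>r\<in>B. 1 - r * b \<in> (*) y ` B"
begin

lemmas B_closed = is_subringD[OF B] is_subring_uminus[OF B] is_subring_power[OF B]

definition pw :: "nat \<Rightarrow> 'k set" where "pw e = (*) (y ^ e) ` B"

lemma pw_submod: "submod B (pw e)"
  unfolding submod_def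
proof (intro conjI ballI)
  show "0 \<in> pw e" unfolding pw_def using B_closed(1) by (intro image_eqI[of _ _ 0]) auto
  fix a b assume "a \<in> pw e"
  then obtain a' where a: "a = y ^ e * a'" "a' \<in> B" by (auto simp: pw_def)
  {
    assume "b \<in> pw e"
    then obtain b' where "b = y ^ e * b'" "b' \<in> B" by (auto simp: pw_def)
    then show "a + b \<in> pw e" unfolding pw_def using a B_closed
      by (intro image_eqI[of _ _ "a' + b'"]) (auto simp: distrib_left)
  }
  assume "b \<in> B"
  then show "b * a \<in> pw e" unfolding pw_def using a B_closed
    by (intro image_eqI[of _ _ "b * a'"]) auto
qed

lemmas pw_closed = submodD[OF pw_submod] submod_uminus[OF B pw_submod] submod_diff[OF B pw_submod]

lemma pw_0: "pw 0 = B" by (simp add: pw_def)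

lemma pw_1: "pw 1 = (*) y ` B" by (simp add: pw_def)

lemma pw_mult: "a \<in> pw e \<Longrightarrow> b \<in> pw e' \<Longrightarrow> a * b \<in> pw (e + e')"
proof -
  assume "a \<in> pw e" "b \<in> pw e'"
  then obtain a' b' where "a = y ^ e * a'" "a' \<in> B" "b = y ^ e' * b'" "b' \<in> B" by (auto simp: pw_def)
  then show ?thesis unfolding pw_def using B_closed
    by (intro image_eqI[of _ _ "a' * b'"]) (auto simp: power_add)
qed

lemma pw_cancel: "y ^ e * c \<in> pw (e + e') \<longleftrightarrow> c \<in> pw e'"
  using y by (auto simp: pw_def power_add mult.assoc)

lemma pw_antimono: "e \<le> e' \<Longrightarrow> pw e' \<subseteq> pw e"
proof -
  assume "e \<le> e'"
  then obtain d where "e' = e + d" using le_Suc_ex by blast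
  then show ?thesis using y B_closed by (auto simp: pw_def power_add mult.assoc intro!: imageI)
qed

text \<open>Were \<open>y\<close> a unit of \<open>B\<close>, 1 would be a nonzero multiple of every
  \<open>y ^ e\<close>, and \<open>size 1\<close> at least every power of two.\<close>

lemma one_notin: "1 \<notin> pw 1"
proof
  assume "1 \<in> pw 1"
  then obtain c where c: "1 = y * c" "c \<in> B" by (auto simp: pw_def)
  then have "c \<noteq> 0" by auto
  then have "2 ^ e \<le> size (y ^ e * c ^ e)" for e using c B_closed by (intro size_power) auto
  then have "2 ^ size 1 \<le> size 1" using c(1) by (metis power_mult_distrib power_one)
  then show False using less_exp[of "size 1"] by linarith
qed

lemma pw_prime:
  assumes "a \<in> B" "b \<in> B" "a \<notin> pw 1" "b \<notin> pw 1"
  shows "a * b \<notin> pw 1"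
proof
  assume ab: "a * b \<in> pw 1"
  obtain r where r: "r \<in> B" "1 - r * a \<in> pw 1" using residue[of a] assms pw_1 by auto
  have "(1 - r * a) * b + r * (a * b) \<in> pw 1"
    by (intro pw_closed(2) pw_closed(4)[OF assms(2) r(2)] pw_closed(3)[OF r(1) ab])
  then show False using assms by (simp add: algebra_simps)
qed

lemma pw_mult_exact:
  assumes "a \<in> pw e" "b \<in> pw e'" "a \<notin> pw (Suc e)" "b \<notin> pw (Suc e')"
  shows "a * b \<notin> pw (Suc (e + e'))"
proof -
  obtain a' b' where ab: "a = y ^ e * a'" "a' \<in> B" "b = y ^ e' * b'" "b' \<in> B"
    using assms by (auto simp: pw_def)
  have "a' \<notin> pw 1" "b' \<notin> pw 1" using assms(3,4) ab pw_cancel[of e a' 1] pw_cancel[of e' b' 1] by auto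
  then have "a' * b' \<notin> pw 1" using ab pw_prime by auto
  moreover have "a * b = y ^ (e + e') * (a' * b')" by (simp add: ab power_add)
  ultimately show ?thesis using pw_cancel[of "e + e'" "a' * b'" 1] by simp
qed

text \<open>A \<open>y\<close>-adic Cauchy sequence converging so fast, relative to the size of its members, that its
  limit is transcendental over \<open>B\<close> (Liouville).\<close>

primrec liouville :: "nat \<Rightarrow> 'k" where
  "liouville 0 = 0"
| "liouville (Suc k) = liouville k + y ^ (k * (size (liouville k) + 1))"

text \<open>The exponent of the term added at step \<open>k\<close>. It is linear in the size of the
  partial sum, so \<open>2 ^ gap k\<close> is exponential in that size; the factor \<open>k\<close>
  eventually beats the degree of any fixed polynomial.\<close>

definition gap :: "nat \<Rightarrow> nat" where "gap k = k * (size (liouville k) + 1)"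

lemma liouville_Suc: "liouville (Suc k) = liouville k + y ^ gap k"
  by (simp add: gap_def)

declare liouville.simps(2) [simp del]

lemma liouville_in_B: "liouville k \<in> B"
  by (induction k) (use y B_closed in \<open>auto simp: liouville_Suc\<close>)

lemma le_gap: "k \<le> gap k" by (simp add: gap_def)

text \<open>Growing sizes make the sequence injective, so that it avoids the roots of a given
  nonzero polynomial from some index on. The bound \<open>k \<ge> 1\<close> is there because
  \<open>gap 0 = 0\<close>.\<close>

lemma size_liouville_less:
  assumes "k \<ge> 1"
  shows "size (liouville k) < size (liouville (Suc k))"
proof -
  define s where "s = size (liouville k)"
  have "2 ^ gap k \<le> size (y ^ gap k * 1)" using B_closed by (intro size_power) auto
  also have "y ^ gap k * 1 = liouville (Suc k) - liouville k" by (simp add: liouville_Suc)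
  also have "size \<dots> \<le> size (liouville (Suc k)) + s"
    unfolding s_def by (intro size_diff liouville_in_B)
  finally have "2 ^ gap k \<le> size (liouville (Suc k)) + s" .
  moreover have "(2::nat) ^ (s + 1) \<le> 2 ^ gap k"
    using mult_le_mono1[OF assms, of "s + 1"]
    by (intro power_increasing) (auto simp: gap_def s_def)
  then have "2 * 2 ^ s \<le> (2::nat) ^ gap k" by simp
  moreover have "s < 2 ^ s" by (rule less_exp)
  ultimately have "s < size (liouville (Suc k))" by linarith
  then show ?thesis by (simp add: s_def)
qed

lemma inj_on_liouville: "inj_on liouville {1..}"
proof -
  have "strict_mono (\<lambda>k. size (liouville (Suc k)))"
    unfolding strict_mono_Suc_iff using size_liouville_less by auto
  then have inj: "inj (\<lambda>k. size (liouville (Suc k)))" by (rule strict_mono_imp_inj_on)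
  show ?thesis
  proof (rule inj_onI)
    fix a b assume "a \<in> {1..}" "b \<in> {1..}" "liouville a = liouville b"
    then have "liouville (Suc (a - 1)) = liouville (Suc (b - 1))" by simp
    then have "a - 1 = b - 1" using injD[OF inj, of "a - 1" "b - 1"] by metis
    then show "a = b" using \<open>a \<in> {1..}\<close> \<open>b \<in> {1..}\<close> by auto
  qed
qed

lemma gap_mono: "k \<le> j \<Longrightarrow> gap k \<le> gap j"
proof (induction j rule: dec_induct)
  case (step j)
  have "gap j \<le> gap (Suc j)"
  proof (cases "j = 0")
    case False
    then show ?thesis using size_liouville_less[of j] unfolding gap_def by (intro mult_mono) auto
  qed (simp add: gap_def)
  then show ?case using step by simp
qed simp

lemma liouville_diff: "k \<le> j \<Longrightarrow> liouville j - liouville k \<in> pw (gap k)"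
proof (induction j rule: dec_induct)
  case base
  then show ?case by (simp add: pw_closed)
next
  case (step j)
  have "y ^ gap j \<in> pw (gap j)" unfolding pw_def using B_closed by (intro image_eqI[of _ _ 1]) auto
  then have "y ^ gap j \<in> pw (gap k)" using pw_antimono[OF gap_mono[OF step(1)]] by blast
  then have "(liouville j - liouville k) + y ^ gap j \<in> pw (gap k)" using step by (intro pw_closed(2))
  then show ?case by (simp add: liouville_Suc algebra_simps)
qed

definition PB :: "'k poly set" where "PB = {f. \<forall>i. coeff f i \<in> B}"

lemma PB_pCons: "pCons a f \<in> PB \<longleftrightarrow> a \<in> B \<and> f \<in> PB"
  unfolding PB_def by (auto simp: coeff_pCons split: nat.splits)

lemma PB_subring: "is_subring PB"
  unfolding is_subring_def
proof (intro conjI ballI)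
  show "0 \<in> PB" "1 \<in> PB" using B_closed by (auto simp: PB_def coeff_1)
  fix f g assume "f \<in> PB" "g \<in> PB"
  then show "f + g \<in> PB" "f - g \<in> PB" "f * g \<in> PB"
    using B_closed by (auto simp: PB_def coeff_mult intro: is_subring_sum[OF B])
qed

lemma poly_in_B:
  assumes "f \<in> PB" "a \<in> B"
  shows "poly f a \<in> B"
  using assms(1) by (induction f) (use assms(2) B_closed in \<open>auto simp: PB_pCons\<close>)

lemma poly_diff_pw:
  assumes f: "f \<in> PB" and ab: "a \<in> B" "b \<in> B" "a - b \<in> pw e"
  shows "poly f a - poly f b \<in> pw e"
  using f
proof (induction f)
  case 0
  then show ?case by (simp add: pw_closed)
next
  case (pCons c f)
  have "poly (pCons c f) a - poly (pCons c f) b = poly f a * (a - b) + b * (poly f a - poly f b)"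
    by (simp add: algebra_simps)
  also have "\<dots> \<in> pw e"
    using pCons.prems by (intro pw_closed(2) pw_closed(3) poly_in_B ab pCons.IH) (auto simp: PB_pCons)
  finally show ?case .
qed

lemma size_poly_bound:
  assumes "f \<in> PB"
  shows "\<exists>C d. \<forall>a\<in>B. size (poly f a) \<le> C * (size a + 1) ^ d"
  using assms
proof (induction f)
  case 0
  then show ?case by (intro exI[of _ "size 0"] exI[of _ 0]) auto
next
  case (pCons c f)
  have cf: "c \<in> B" "f \<in> PB" using pCons.prems by (auto simp: PB_pCons)
  then obtain C d where C: "\<And>a. a \<in> B \<Longrightarrow> size (poly f a) \<le> C * (size a + 1) ^ d" using pCons.IH by blast
  have "size (poly (pCons c f) a) \<le> (size c + C) * (size a + 1) ^ Suc d" if a: "a \<in> B" for a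
  proof -
    have "size (poly (pCons c f) a) \<le> size c + size (a * poly f a)"
      using size_add[of c "a * poly f a"] cf a poly_in_B B_closed by simp
    also have "size (a * poly f a) \<le> size a * size (poly f a)"
      using cf a poly_in_B by (intro size_mult)
    also have "\<dots> \<le> (size a + 1) * (C * (size a + 1) ^ d)"
      using C[OF a] by (intro mult_mono) auto
    also have "size c \<le> size c * (size a + 1) ^ Suc d"
      using mult_le_mono2[of 1 "(size a + 1) ^ Suc d" "size c"] by (simp del: power_Suc)
    finally show ?thesis by (simp add: algebra_simps)
  qed
  then show ?case by blast
qed

text \<open>\<open>y ^ e\<close> divides the value of \<open>f\<close> at the limit of the sequence.\<close>

definition dvl :: "nat \<Rightarrow> 'k poly \<Rightarrow> bool" where
  "dvl e f \<longleftrightarrow> (\<forall>k\<ge>e. poly f (liouville k) \<in> pw e)"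

text \<open>All terms from index \<open>e\<close> on agree modulo \<open>y ^ e\<close>, as
  \<open>e \<le> gap e\<close>, so a single one of them decides.\<close>

lemma dvl_iff:
  assumes f: "f \<in> PB" and k: "e \<le> k"
  shows "dvl e f \<longleftrightarrow> poly f (liouville k) \<in> pw e"
proof
  assume *: "poly f (liouville k) \<in> pw e"
  have "poly f (liouville j) \<in> pw e" if j: "e \<le> j" for j
  proof -
    have "liouville j - liouville e \<in> pw e" "liouville k - liouville e \<in> pw e"
      using liouville_diff[OF j] liouville_diff[OF k] pw_antimono[OF le_gap[of e]] by auto
    then have "(liouville j - liouville e) - (liouville k - liouville e) \<in> pw e" by (rule pw_closed)
    then have "poly f (liouville j) - poly f (liouville k) \<in> pw e"
      by (intro poly_diff_pw f liouville_in_B) simp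
    then show ?thesis using pw_closed(2)[OF _ *] by fastforce
  qed
  then show "dvl e f" by (simp add: dvl_def)
qed (use k in \<open>simp add: dvl_def\<close>)

lemma dvl_0: "f \<in> PB \<Longrightarrow> dvl 0 f"
  using poly_in_B liouville_in_B by (simp add: dvl_def pw_0)

lemma dvl_zero_poly: "dvl e 0" by (simp add: dvl_def pw_closed)

lemma dvl_add: "dvl e f \<Longrightarrow> dvl e g \<Longrightarrow> dvl e (f + g)"
  and dvl_diff: "dvl e f \<Longrightarrow> dvl e g \<Longrightarrow> dvl e (f - g)"
  by (auto simp: dvl_def pw_closed)

lemma dvl_antimono: "f \<in> PB \<Longrightarrow> dvl e' f \<Longrightarrow> e \<le> e' \<Longrightarrow> dvl e f"
  using dvl_iff[of f e' e'] dvl_iff[of f e e'] pw_antimono[of e e'] by auto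

lemma dvl_mult: "f \<in> PB \<Longrightarrow> g \<in> PB \<Longrightarrow> dvl e f \<Longrightarrow> dvl e' g \<Longrightarrow> dvl (e + e') (f * g)"
  using is_subringD(5)[OF PB_subring] by (auto simp: dvl_def pw_mult)

lemma dvl_mult_exact:
  assumes "f \<in> PB" "g \<in> PB" "dvl e f" "dvl e' g" "\<not> dvl (Suc e) f" "\<not> dvl (Suc e') g"
  shows "\<not> dvl (Suc (e + e')) (f * g)"
proof -
  define k where "k = Suc (e + e')"
  have "poly f (liouville k) * poly g (liouville k) \<notin> pw (Suc (e + e'))"
    using assms by (intro pw_mult_exact) (auto simp: dvl_iff[where k = k] k_def)
  then show ?thesis using is_subringD(5)[OF PB_subring assms(1,2)] by (simp add: dvl_iff[where k = k] k_def)
qed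

text \<open>Liouville's argument. For large \<open>k\<close> the value at \<open>liouville k\<close>
  is nonzero and polynomially bounded in the size of \<open>liouville k\<close>, hence too small for
  a multiple of \<open>y ^ gap k\<close>. All later values agree with it modulo
  \<open>y ^ gap k\<close>, so the limit is not a root of \<open>f\<close>.\<close>

lemma not_dvl_exists:
  assumes f: "f \<in> PB" "f \<noteq> 0"
  shows "\<exists>e. \<not> dvl e f"
proof -
  obtain C d where C: "\<And>a. a \<in> B \<Longrightarrow> size (poly f a) \<le> C * (size a + 1) ^ d"
    using size_poly_bound[OF f(1)] by blast
  have "finite (liouville -` {x. poly f x = 0} \<inter> {1..})"
    by (rule finite_vimage_IntI[OF _ inj_on_liouville]) (use f poly_roots_finite in auto)
  then obtain k0 where k0: "\<forall>k\<in>liouville -` {x. poly f x = 0} \<inter> {1..}. k \<le> k0"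
    using finite_nat_set_iff_bounded_le by blast
  have nz: "poly f (liouville k) \<noteq> 0" if "k > k0" for k
  proof
    assume "poly f (liouville k) = 0"
    then have "k \<in> liouville -` {x. poly f x = 0} \<inter> {1..}" using that by simp
    then have "k \<le> k0" using k0 by blast
    then show False using that by simp
  qed
  \<comment> \<open>Beyond \<open>k0\<close> for a nonzero value, and large enough that
    \<open>d \<le> k\<close> and \<open>C < 2 ^ k\<close>.\<close>
  define k where "k = k0 + C + d + 1"
  define s where "s = size (liouville k)"
  have "poly f (liouville k) \<notin> pw (gap k)"
  proof
    assume "poly f (liouville k) \<in> pw (gap k)"
    then obtain c where c: "poly f (liouville k) = y ^ gap k * c" "c \<in> B" by (auto simp: pw_def)
    moreover have "c \<noteq> 0" using nz[of k] c by (auto simp: k_def)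
    ultimately have "2 ^ gap k \<le> size (poly f (liouville k))" using size_power by simp
    also have "\<dots> \<le> C * (s + 1) ^ d" unfolding s_def by (rule C[OF liouville_in_B])
    also have "\<dots> \<le> C * (2 ^ s) ^ d"
      by (intro mult_left_mono power_mono) (auto simp: Suc_le_eq less_exp)
    also have "\<dots> \<le> C * 2 ^ (k * s)"
      unfolding power_mult[symmetric] using mult_le_mono1[of d k s]
      by (intro mult_left_mono power_increasing) (auto simp: k_def mult.commute)
    also have "\<dots> < 2 ^ k * 2 ^ (k * s)"
      using less_exp[of k] by (intro mult_strict_right_mono) (auto simp: k_def)
    also have "\<dots> = 2 ^ gap k" by (simp add: gap_def s_def power_add)
    finally show False by simp
  qed
  then have "\<not> dvl (gap k) f"
  proof (rule contrapos_nn)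
    assume "dvl (gap k) f"
    then have "poly f (liouville (gap k)) \<in> pw (gap k)" by (simp add: dvl_def)
    moreover have "poly f (liouville (gap k)) - poly f (liouville k) \<in> pw (gap k)"
      by (intro poly_diff_pw f liouville_in_B liouville_diff le_gap)
    ultimately have "poly f (liouville (gap k)) - (poly f (liouville (gap k)) - poly f (liouville k)) \<in> pw (gap k)"
      by (rule pw_closed)
    then show "poly f (liouville k) \<in> pw (gap k)" by simp
  qed
  then show ?thesis by blast
qed

section \<open>The valuation on polynomials over \<open>B\<close> and the pair it induces in
  \<open>T\<close>\<close>

text \<open>The order of \<open>f\<close> at the limit. \<open>v 0\<close> carries no meaning, since
  \<open>dvl e 0\<close> always holds; numerators that may vanish are therefore handled by
  \<open>dvl\<close>.\<close>

definition v :: "'k poly \<Rightarrow> nat" where "v f = (LEAST e. \<not> dvl (Suc e) f)"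

lemma dvl_v:
  assumes f: "f \<in> PB" "f \<noteq> 0"
  shows "dvl (v f) f" "\<not> dvl (Suc (v f)) f"
proof -
  obtain e where e: "\<not> dvl e f" using not_dvl_exists[OF f] by blast
  then have "e \<noteq> 0" using dvl_0[OF f(1)] by metis
  then have "\<exists>e. \<not> dvl (Suc e) f" using e by (metis not0_implies_Suc)
  then show "\<not> dvl (Suc (v f)) f" unfolding v_def by (rule LeastI_ex)
  show "dvl (v f) f"
  proof (cases "v f")
    case (Suc e')
    then show ?thesis using not_less_Least[of e' "\<lambda>e. \<not> dvl (Suc e) f"] by (auto simp: v_def)
  qed (simp add: dvl_0 f)
qed

lemma v_eqI: "f \<in> PB \<Longrightarrow> f \<noteq> 0 \<Longrightarrow> dvl e f \<Longrightarrow> \<not> dvl (Suc e) f \<Longrightarrow> v f = e"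
  using dvl_v[of f] dvl_antimono[of f] by (metis Suc_leI linorder_neqE_nat)

lemma v_mult:
  assumes "f \<in> PB" "g \<in> PB" "f \<noteq> 0" "g \<noteq> 0"
  shows "v (f * g) = v f + v g"
  using assms dvl_v[of f] dvl_v[of g] is_subringD(5)[OF PB_subring]
  by (intro v_eqI) (auto simp: dvl_mult dvl_mult_exact)

lemma v_y_power: "v [:y ^ e:] = e"
proof (rule v_eqI)
  show "[:y ^ e:] \<in> PB" using y B_closed by (simp add: PB_pCons is_subringD(1)[OF PB_subring])
  have "y ^ e \<in> pw e" unfolding pw_def using B_closed by (intro image_eqI[of _ _ 1]) auto
  moreover have "y ^ e \<notin> pw (Suc e)" using pw_cancel[of e 1 1] one_notin by simp
  ultimately show "dvl e [:y ^ e:]" "\<not> dvl (Suc e) [:y ^ e:]" by (auto simp: dvl_def)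
qed (use y in auto)

text \<open>The residue field does not grow: modulo a power of \<open>y\<close> the limit may be
  replaced by a term of the sequence, which lies in \<open>B\<close>, so the class of
  \<open>g / f\<close> is represented by an element of \<open>B\<close>.\<close>

lemma dvl_residue:
  assumes f: "f \<in> PB" "dvl e f" "\<not> dvl (Suc e) f" and g: "g \<in> PB" "dvl e g"
  shows "\<exists>r\<in>B. dvl (Suc e) (g - smult r f)"
proof -
  define k where "k = Suc e"
  obtain a where a: "poly f (liouville k) = y ^ e * a" "a \<in> B"
    using f by (auto simp: dvl_iff[where k = k] k_def pw_def)
  obtain b where b: "poly g (liouville k) = y ^ e * b" "b \<in> B"
    using g by (auto simp: dvl_iff[where k = k] k_def pw_def)
  have "a \<notin> pw 1" using f a pw_cancel[of e a 1] by (simp add: dvl_iff[where k = k] k_def)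
  then obtain r where r: "r \<in> B" "1 - r * a \<in> pw 1" using residue[of a] a pw_1 by auto
  have brB: "b * r \<in> B" using b r B_closed by auto
  have mem: "g - smult (b * r) f \<in> PB"
    using f g brB B_closed by (auto simp: PB_def)
  have "y ^ e * (b * (1 - r * a)) \<in> pw (e + 1)"
    unfolding pw_cancel by (rule pw_closed(3)[OF b(2) r(2)])
  also have "y ^ e * (b * (1 - r * a)) = poly (g - smult (b * r) f) (liouville k)"
    by (simp add: a b algebra_simps)
  finally have "dvl (Suc e) (g - smult (b * r) f)"
    by (simp add: dvl_iff[OF mem, where k = k] k_def)
  with brB show ?thesis by blast
qed

text \<open>\<open>R\<close> will be the constants \<open>B\<close> or all of \<open>B[t]\<close>.
  Evaluation at \<open>t\<close> embeds it into \<open>T/Q\<close>, and the valuation of its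
  fractions cuts out the pair \<open>(W 0, W 1)\<close> in \<open>T\<close>.\<close>

theorem maximal_subring_if_algebraic:
  fixes h :: "'k \<Rightarrow> 'a::comm_ring_1" and Q :: "'a set"
  assumes hom: "h 1 = 1" "\<And>a b. h (a + b) = h a + h b" "\<And>a b. h (a * b) = h a * h b"
    and Q: "prime_ideal Q" and R: "is_subring R" "R \<subseteq> PB" "\<And>b. b \<in> B \<Longrightarrow> [:b:] \<in> R"
    and transcendental: "\<And>f. f \<in> R \<Longrightarrow> poly (map_poly h f) t \<in> Q \<Longrightarrow> f = 0"
    and algebraic: "\<And>x. \<exists>p. (\<forall>i. coeff p i \<in> (\<lambda>f. poly (map_poly h f) t) ` R) \<and>
      (\<exists>i. coeff p i \<notin> Q) \<and> poly p x \<in> Q"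
  shows "\<exists>S. maximal_subring S \<and> integrally_closed_in_ambient S \<and> conductor S = Q"
proof -
  have h0: "h 0 = 0" using hom(2)[of 0 0] by simp
  define \<theta> where "\<theta> f = poly (map_poly h f) t" for f
  have \<theta>_pCons: "\<theta> (pCons a f) = h a + t * \<theta> f" for a f
    by (simp add: \<theta>_def map_poly_pCons h0)
  have \<theta>0: "\<theta> 0 = 0" by (simp add: \<theta>_def)
  have \<theta>_add: "\<theta> (f + g) = \<theta> f + \<theta> g" for f g
    by (induction f g rule: poly_induct2) (simp_all add: \<theta>_pCons \<theta>0 hom algebra_simps)
  have \<theta>_diff: "\<theta> (f - g) = \<theta> f - \<theta> g" for f g
    using \<theta>_add[of "f - g" g] by simp
  have \<theta>_smult: "\<theta> (smult a f) = h a * \<theta> f" for a f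
    by (induction f) (simp_all add: \<theta>_pCons \<theta>0 hom algebra_simps)
  have \<theta>_mult: "\<theta> (f * g) = \<theta> f * \<theta> g" for f g
    by (induction f) (simp_all add: \<theta>_pCons \<theta>0 \<theta>_add \<theta>_smult h0 algebra_simps)
  have \<theta>1: "\<theta> 1 = 1" by (simp add: one_pCons \<theta>_pCons \<theta>0 hom)
  have \<theta>_const: "\<theta> [:b:] = h b" for b by (simp add: \<theta>_pCons \<theta>0)
  have Qm: "submod UNIV Q" using Q by (simp add: prime_ideal_def submod_UNIV)
  note Q_closed = submodD[OF Qm, simplified] submod_diff[OF is_subring_UNIV Qm]
  note R_closed = is_subringD[OF R(1)]
  have R_PB: "f \<in> PB" if "f \<in> R" for f using that R by auto
  \<comment> \<open>Elements of \<open>T\<close> that modulo \<open>Q\<close> equal a fraction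
    \<open>\<theta> f / \<theta> g\<close> of value at least \<open>n\<close>; not every such
    fraction need exist in \<open>T/Q\<close>.\<close>
  define W where "W n = {x. \<exists>g\<in>R. \<exists>f\<in>R. g \<noteq> 0 \<and> \<theta> g * x - \<theta> f \<in> Q \<and> dvl (v g + n) f}" for n
  have WI: "x \<in> W n" if "g \<in> R" "f \<in> R" "g \<noteq> 0" "\<theta> g * x - \<theta> f \<in> Q" "dvl (v g + n) f" for x n g f
    using that unfolding W_def by blast
  have W_R: "\<theta> f \<in> W n" if "f \<in> R" "dvl n f" for f n
    using that R_closed(1,2) v_y_power[of 0]
    by (intro WI[of 1 f]) (auto simp: \<theta>1 Q_closed simp flip: one_pCons)
  have W_antimono: "W (Suc n) \<subseteq> W n" for n
  proof
    fix x assume "x \<in> W (Suc n)"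
    then obtain g f where gf: "g \<in> R" "f \<in> R" "g \<noteq> 0" "\<theta> g * x - \<theta> f \<in> Q" "dvl (v g + Suc n) f"
      unfolding W_def by blast
    show "x \<in> W n"
      by (rule WI[OF gf(1-4) dvl_antimono[OF R_PB[OF gf(2)] gf(5)]]) simp
  qed
  have W_add_diff: "x + x' \<in> W n \<and> x - x' \<in> W n" if "x \<in> W n" "x' \<in> W n" for x x' n
  proof -
    obtain g f where gf: "g \<in> R" "f \<in> R" "g \<noteq> 0" "\<theta> g * x - \<theta> f \<in> Q" "dvl (v g + n) f"
      using \<open>x \<in> W n\<close> unfolding W_def by blast
    obtain g' f' where gf': "g' \<in> R" "f' \<in> R" "g' \<noteq> 0" "\<theta> g' * x' - \<theta> f' \<in> Q" "dvl (v g' + n) f'"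
      using \<open>x' \<in> W n\<close> unfolding W_def by blast
    note PB = R_PB[OF gf(1)] R_PB[OF gf(2)] R_PB[OF gf'(1)] R_PB[OF gf'(2)]
    have Qs: "\<theta> g' * (\<theta> g * x - \<theta> f) \<in> Q" "\<theta> g * (\<theta> g' * x' - \<theta> f') \<in> Q"
      using Q_closed(3) gf(4) gf'(4) by blast+
    have d: "dvl (v (g * g') + n) (f * g')" "dvl (v (g * g') + n) (g * f')"
      using dvl_mult[OF PB(2,3) gf(5) dvl_v(1)[OF PB(3) gf'(3)]] dvl_mult[OF PB(1,4) dvl_v(1)[OF PB(1) gf(3)] gf'(5)]
        v_mult[OF PB(1,3) gf(3) gf'(3)] by (simp_all add: algebra_simps)
    show ?thesis
    proof
      have "\<theta> (g * g') * (x + x') - \<theta> (f * g' + g * f') \<in> Q"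
        using Q_closed(2)[OF Qs] by (simp add: \<theta>_add \<theta>_mult algebra_simps)
      then show "x + x' \<in> W n"
        using gf(3) gf'(3) dvl_add[OF d]
        by (intro WI[of "g * g'" "f * g' + g * f'"] R_closed(3,5) gf(1,2) gf'(1,2)) auto
      have "\<theta> (g * g') * (x - x') - \<theta> (f * g' - g * f') \<in> Q"
        using Q_closed(5)[OF Qs] by (simp add: \<theta>_diff \<theta>_mult algebra_simps)
      then show "x - x' \<in> W n"
        using gf(3) gf'(3) dvl_diff[OF d]
        by (intro WI[of "g * g'" "f * g' - g * f'"] R_closed(4,5) gf(1,2) gf'(1,2)) auto
    qed
  qed
  have W_mult: "x * x' \<in> W (n + n')" if "x \<in> W n" "x' \<in> W n'" for x x' n n'
  proof -
    obtain g f where gf: "g \<in> R" "f \<in> R" "g \<noteq> 0" "\<theta> g * x - \<theta> f \<in> Q" "dvl (v g + n) f"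
      using \<open>x \<in> W n\<close> unfolding W_def by blast
    obtain g' f' where gf': "g' \<in> R" "f' \<in> R" "g' \<noteq> 0" "\<theta> g' * x' - \<theta> f' \<in> Q" "dvl (v g' + n') f'"
      using \<open>x' \<in> W n'\<close> unfolding W_def by blast
    note PB = R_PB[OF gf(1)] R_PB[OF gf(2)] R_PB[OF gf'(1)] R_PB[OF gf'(2)]
    have "\<theta> g * x * (\<theta> g' * x' - \<theta> f') + \<theta> f' * (\<theta> g * x - \<theta> f) \<in> Q"
      by (intro Q_closed(2,3) gf(4) gf'(4))
    then have "\<theta> (g * g') * (x * x') - \<theta> (f * f') \<in> Q" by (simp add: \<theta>_mult algebra_simps)
    moreover have "dvl (v (g * g') + (n + n')) (f * f')"
      using dvl_mult[OF PB(2,4) gf(5) gf'(5)] v_mult[OF PB(1,3) gf(3) gf'(3)] by (simp add: algebra_simps)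
    ultimately show ?thesis
      using gf(3) gf'(3)
      by (intro WI[of "g * g'" "f * f'"] R_closed(5) gf(1,2) gf'(1,2)) auto
  qed
  \<comment> \<open>The value does not depend on the fraction: two fractions for \<open>x\<close>
    satisfy \<open>g * f' = g' * f\<close> by \<open>transcendental\<close>, so exact value
    \<open>n\<close> excludes a representation of value \<open>n + 1\<close>.\<close>
  have W_notin: "x \<notin> W (Suc n)"
    if g: "g \<in> R" "f \<in> R" "g \<noteq> 0" "f \<noteq> 0" "\<theta> g * x - \<theta> f \<in> Q" "v f = v g + n" for x g f n
  proof
    assume "x \<in> W (Suc n)"
    then obtain g' f' where gf': "g' \<in> R" "f' \<in> R" "g' \<noteq> 0" "\<theta> g' * x - \<theta> f' \<in> Q" "dvl (v g' + Suc n) f'"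
      unfolding W_def by blast
    have "\<theta> g' * (\<theta> g * x - \<theta> f) - \<theta> g * (\<theta> g' * x - \<theta> f') \<in> Q"
      by (intro Q_closed(5) Q_closed(3) g(5) gf'(4))
    then have "\<theta> (g * f' - g' * f) \<in> Q" by (simp add: \<theta>_diff \<theta>_mult algebra_simps)
    moreover have "g * f' - g' * f \<in> R" by (intro R_closed(4,5) g(1,2) gf'(1,2))
    ultimately have "g * f' - g' * f = 0" using transcendental unfolding \<theta>_def by blast
    then have eq: "g * f' = g' * f" by simp
    then have "f' \<noteq> 0" using g gf' by auto
    then have "v g + v f' = v g' + v f"
      using v_mult[of g f'] v_mult[of g' f] g(1-4) gf'(1-3) R_PB eq by metis
    then have "v f' = v g' + n" using g(6) by simp
    then show False using dvl_v(2)[OF R_PB[OF gf'(2)] \<open>f' \<noteq> 0\<close>] gf'(5)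
        dvl_antimono[OF R_PB[OF gf'(2)] gf'(5)] by simp
  qed
  show ?thesis
  proof (rule maximal_subring_of_residue_field[where A = "W 0" and I = "W 1" and y = "h y" and y' = "h (inverse y)"])
    show "prime_ideal Q" by (rule Q)
    show "Q \<subseteq> W 1"
    proof
      fix x assume "x \<in> Q"
      then show "x \<in> W 1" using R_closed(1,2) by (intro WI[of 1 0]) (auto simp: \<theta>1 \<theta>0 dvl_zero_poly)
    qed
    have W01: "0 \<in> W n" for n using W_R[of 0 n] R_closed(1) by (simp add: \<theta>0 dvl_zero_poly)
    show "is_subring (W 0)"
      using W01[of 0] W_R[of 1 0] R_closed(2) W_add_diff[of _ 0] W_mult[of _ 0 _ 0] R_PB dvl_0
      by (auto simp: is_subring_def \<theta>1)
    show "W 1 \<subseteq> W 0" using W_antimono[of 0] by simp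
    show "submod (W 0) (W 1)"
      using W01[of 1] W_add_diff[of _ 1] W_mult[of _ 0 _ 1] by (auto simp: submod_def)
    show "1 \<notin> W 1"
      using W_notin[of 1 1 1 0] R_closed(2) by (simp add: Q_closed)
    show "\<exists>r\<in>W 0. 1 - r * a \<in> W 1" if a: "a \<in> W 0" "a \<notin> W 1" for a
    proof -
      obtain g f where gf: "g \<in> R" "f \<in> R" "g \<noteq> 0" "\<theta> g * a - \<theta> f \<in> Q" "dvl (v g) f"
        using a(1) unfolding W_def by auto
      have "\<not> dvl (Suc (v g)) f" using WI[of g f a 1] gf a(2) by auto
      \<comment> \<open>Here the unchanged residue field enters: \<open>a\<close> stands for
        \<open>f / g\<close>, and its inverse modulo \<open>W 1\<close> is the image of a constant
        \<open>r \<in> B\<close>, hence available in \<open>T\<close>.\<close>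
      then obtain r where r: "r \<in> B" "dvl (Suc (v g)) (g - smult r f)"
        using dvl_residue[of f "v g" g] gf dvl_v(1)[of g] R_PB by auto
      have rR: "[:r:] \<in> R" using r R by auto
      have sm: "smult r f \<in> R" using R_closed(5)[OF rR gf(2)] by simp
      have "- h r * (\<theta> g * a - \<theta> f) \<in> Q" using gf Q_closed by blast
      then have "1 - h r * a \<in> W 1"
        using gf r sm R_closed
        by (intro WI[of g "g - smult r f"]) (auto simp: \<theta>_diff \<theta>_smult algebra_simps)
      moreover have "h r \<in> W 0" using W_R[OF rR dvl_0[OF R_PB[OF rR]]] by (simp add: \<theta>_const)
      ultimately show ?thesis by blast
    qed
    have yR: "[:y ^ e:] \<in> R" for e using R(3) y B_closed by auto
    show "h y \<in> W 1"
      using W_R[OF yR[of 1], of 1] dvl_v(1)[OF R_PB[OF yR[of 1]]] v_y_power[of 1] y by (simp add: \<theta>_const)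
    show yinv: "h y * h (inverse y) = 1" using y hom by (metis right_inverse)
    fix x
    obtain p where p: "\<And>i. coeff p i \<in> \<theta> ` R" "\<exists>i. coeff p i \<notin> Q" "poly p x \<in> Q"
      using algebraic[of x] unfolding \<theta>_def by blast
    have "coeff p i \<in> Q \<or> (\<exists>e. coeff p i * h (inverse y) ^ e \<in> W 0 - W 1)" for i
    proof (cases "coeff p i \<in> Q")
      case False
      obtain f where f: "f \<in> R" "coeff p i = \<theta> f" using p(1)[of i] by blast
      have f0: "f \<noteq> 0" using False f Q_closed(1) by (auto simp: \<theta>0)
      \<comment> \<open>Dividing the coefficient \<open>\<theta> f\<close> by \<open>y ^ v f\<close>
        produces an element of value exactly 0.\<close>
      define e where "e = v f"
      define z where "z = coeff p i * h (inverse y) ^ e"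
      have "h (y ^ n) = h y ^ n" for n by (induction n) (simp_all add: hom)
      then have "\<theta> [:y ^ e:] * z - \<theta> f = ((h y * h (inverse y)) ^ e - 1) * \<theta> f"
        by (simp add: z_def f \<theta>_const power_mult_distrib algebra_simps)
      then have Qz: "\<theta> [:y ^ e:] * z - \<theta> f \<in> Q" using yinv Q_closed(1) by simp
      have "z \<in> W 0"
        using Qz f dvl_v(1)[of f] f0 R_PB y v_y_power[of e] by (intro WI[OF yR[of e] f(1)]) (auto simp: e_def)
      moreover have "z \<notin> W (Suc 0)"
        using Qz f f0 y v_y_power[of e] by (intro W_notin[OF yR[of e] f(1)]) (auto simp: e_def)
      ultimately show ?thesis by (auto simp: z_def)
    qed simp
    with p show "\<exists>p. (\<forall>i. coeff p i \<in> Q \<or> (\<exists>e. coeff p i * h (inverse y) ^ e \<in> W 0 - W 1)) \<and>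
      (\<exists>i. coeff p i \<notin> Q) \<and> poly p x \<in> Q" by blast
  qed
qed

end

section \<open>Base rings of fields that are not absolutely algebraic\<close>

definition fractions :: "'k::field set \<Rightarrow> 'k set" where
  "fractions B = {a / b | a b. a \<in> B \<and> b \<in> B \<and> b \<noteq> 0}"

lemma fractionsI: "a \<in> B \<Longrightarrow> b \<in> B \<Longrightarrow> b \<noteq> 0 \<Longrightarrow> a / b \<in> fractions B"
  by (auto simp: fractions_def)

lemma subset_fractions: "is_subring B \<Longrightarrow> B \<subseteq> fractions B"
  using fractionsI[of _ B 1] is_subringD(2)[of B] by auto

lemma is_subfield_fractions:
  assumes B: "is_subring B"
  shows "is_subfield (fractions B)"
  unfolding is_subfield_def
proof
  note B_closed = is_subringD[OF B]
  have "x + y \<in> fractions B \<and> x - y \<in> fractions B \<and> x * y \<in> fractions B"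
    if xy: "x \<in> fractions B" "y \<in> fractions B" for x y
  proof -
    obtain a b c d where *: "x = a / b" "a \<in> B" "b \<in> B" "b \<noteq> 0" "y = c / d" "c \<in> B" "d \<in> B" "d \<noteq> 0"
      using xy unfolding fractions_def by blast
    have "(a * d + c * b) / (b * d) \<in> fractions B" "(a * d - c * b) / (b * d) \<in> fractions B"
      "(a * c) / (b * d) \<in> fractions B"
      using * B_closed by (auto intro!: fractionsI)
    then show ?thesis using * by (simp add: add_frac_eq diff_frac_eq)
  qed
  then show "is_subring (fractions B)"
    using subset_fractions[OF B] B_closed by (auto simp: is_subring_def)
  show "\<forall>x\<in>fractions B. inverse x \<in> fractions B"
  proof
    fix x assume "x \<in> fractions B"
    then obtain a b where *: "x = a / b" "a \<in> B" "b \<in> B" "b \<noteq> 0" by (auto simp: fractions_def)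
    then show "inverse x \<in> fractions B"
      using B_closed fractionsI[of b B a] subset_fractions[OF B] by (cases "a = 0") auto
  qed
qed

lemma common_denominator:
  assumes B: "is_subring B"
  shows "finite I \<Longrightarrow> (\<And>i. i \<in> I \<Longrightarrow> e i \<in> fractions B) \<Longrightarrow> \<exists>b\<in>B. b \<noteq> 0 \<and> (\<forall>i\<in>I. b * e i \<in> B)"
proof (induction I rule: finite_induct)
  case empty
  then show ?case using is_subringD(2)[OF B] by (intro bexI[of _ 1]) auto
next
  case (insert i I)
  then obtain b where b: "b \<in> B" "b \<noteq> 0" "\<And>i. i \<in> I \<Longrightarrow> b * e i \<in> B" by auto
  obtain p q where pq: "e i = p / q" "p \<in> B" "q \<in> B" "q \<noteq> 0"
    using insert.prems[of i] by (auto simp: fractions_def)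
  have "q * b * e j \<in> B" if "j \<in> insert i I" for j
  proof (cases "j = i")
    case True
    then have eq: "q * b * e j = b * p" using pq by simp
    show ?thesis unfolding eq by (intro is_subringD(5)[OF B] b pq)
  next
    case False
    then have "b * e j \<in> B" using that b(3) by blast
    then have "q * (b * e j) \<in> B" using pq(3) by (rule is_subringD(5)[OF B, rotated])
    then show ?thesis by (simp add: mult.assoc)
  qed
  moreover have "q * b \<in> B" "q * b \<noteq> 0" using b pq is_subringD(5)[OF B] by auto
  ultimately show ?case by blast
qed

lemma single_zero_in_prime_ideal:
  assumes "prime_ideal Q" "const b \<in> Q"
  shows "b = (0::'k::field)"
proof (rule ccontr)
  assume "b \<noteq> 0"
  have Q: "submod UNIV Q" "Q \<noteq> UNIV" using assms by (auto simp: prime_ideal_def submod_UNIV)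
  have "const (inverse b) * const b \<in> Q" by (intro submodD(3)[OF Q(1)] assms) simp
  then have "1 \<in> Q" using \<open>b \<noteq> 0\<close> by (simp add: mult_single)
  then have "x \<in> Q" for x using submodD(3)[OF Q(1), of x 1] by simp
  then show False using Q(2) by auto
qed

lemma (in sized_ring) maximal_subring_with_conductor:
  fixes Q :: "(('v::finite \<Rightarrow>\<^sub>0 nat) \<Rightarrow>\<^sub>0 'k) set"
  assumes alg: "\<And>a. algebraic_over B a"
    and Q: "prime_ideal Q" "enat (CARD('v) - 1) \<le> height Q"
  shows "\<exists>S. maximal_subring S \<and> integrally_closed_in_ambient S \<and> conductor S = Q"
proof -
  let ?h = "const :: 'k \<Rightarrow> ('v \<Rightarrow>\<^sub>0 nat) \<Rightarrow>\<^sub>0 'k"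
  have hom: "?h 1 = 1" "?h (a + b) = ?h a + ?h b" "?h (a * b) = ?h a * ?h b" for a b
    by (simp_all add: single_add mult_single)
  have \<theta>: "poly (map_poly ?h f) t = (\<Sum>j<n. ?h (coeff f j) * t ^ j)" if "\<And>j. n \<le> j \<Longrightarrow> coeff f j = 0" for f n t
    using poly_eq_sum_lessThan[of n "map_poly ?h f" t] that by (simp add: coeff_map_poly)
  show ?thesis
  proof (cases "\<forall>x. \<exists>N c. (\<forall>i<N. c i \<in> B) \<and> (\<exists>i<N. c i \<noteq> 0) \<and> (\<Sum>i<N. ?h (c i) * x ^ i) \<in> Q")
    case True
    \<comment> \<open>All elements are algebraic over \<open>B\<close> itself modulo
      \<open>Q\<close>. The evaluation point 0 is a dummy, as constants do not depend on it.\<close>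
    define R where "R = (\<lambda>b. [:b:]) ` B"
    show ?thesis
    proof (rule maximal_subring_if_algebraic[of ?h Q R 0, OF hom Q(1)])
      show "is_subring R"
        unfolding is_subring_def R_def using B_closed
        by (auto intro!: image_eqI[of _ _ 0] image_eqI[of _ _ 1] simp: one_pCons)
      show "R \<subseteq> PB" using B_closed by (auto simp: R_def PB_pCons is_subringD(1)[OF PB_subring])
      show "[:b:] \<in> R" if "b \<in> B" for b using that by (auto simp: R_def)
      show "f = 0" if "f \<in> R" "poly (map_poly ?h f) 0 \<in> Q" for f
        using that single_zero_in_prime_ideal[OF Q(1)] by (auto simp: R_def map_poly_pCons)
      fix x
      obtain N c where c: "\<And>i. i < N \<Longrightarrow> c i \<in> B" "\<exists>i<N. c i \<noteq> 0" "(\<Sum>i<N. ?h (c i) * x ^ i) \<in> Q"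
        using True by blast
      define p where "p = (\<Sum>i<N. monom (?h (c i)) i)"
      have co: "coeff p i = (if i < N then ?h (c i) else 0)" for i by (simp add: p_def coeff_sum_monom)
      have "coeff p i \<in> (\<lambda>f. poly (map_poly ?h f) 0) ` R" for i
      proof -
        have "[:if i < N then c i else 0:] \<in> R" using c(1) B_closed by (auto simp: R_def)
        then show ?thesis by (rule rev_image_eqI) (simp add: co map_poly_pCons)
      qed
      moreover have "\<exists>i. coeff p i \<notin> Q"
        using c(2) single_zero_in_prime_ideal[OF Q(1)] by (auto simp: co)
      moreover have "poly p x \<in> Q" using c(3) by (simp add: p_def poly_sum poly_monom)
      ultimately show "\<exists>p. (\<forall>i. coeff p i \<in> (\<lambda>f. poly (map_poly ?h f) 0) ` R) \<and>
        (\<exists>i. coeff p i \<notin> Q) \<and> poly p x \<in> Q" by blast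
    qed
  next
    case False
    then obtain t where t: "\<And>N c. (\<forall>i<N. c i \<in> B) \<Longrightarrow> (\<Sum>i<N. ?h (c i) * t ^ i) \<in> Q \<Longrightarrow> \<forall>i<N. c i = 0"
      by blast
    have trans: "f = 0" if f: "f \<in> PB" "poly (map_poly ?h f) t \<in> Q" for f
    proof -
      have "\<forall>i<Suc (degree f). coeff f i = 0"
        using f \<theta>[of "Suc (degree f)" f t] by (intro t) (auto simp: PB_def coeff_eq_0)
      then show ?thesis by (metis leading_coeff_0_iff lessI)
    qed
    show ?thesis
    proof (rule maximal_subring_if_algebraic[of ?h Q PB t, OF hom Q(1) PB_subring subset_refl _ trans])
      show "[:b:] \<in> PB" if "b \<in> B" for b using that by (simp add: PB_pCons is_subringD(1)[OF PB_subring])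
      fix x
      have E: "is_subfield (fractions B)" "algebraic_over (fractions B) a" for a
        using is_subfield_fractions[OF B] alg[of a] subset_fractions[OF B]
        unfolding algebraic_over_def by blast+
      obtain N e where e: "\<forall>i<N. \<forall>j<N. e i j \<in> fractions B" "\<exists>i<N. \<exists>j<N. e i j \<noteq> 0"
        "(\<Sum>i<N. \<Sum>j<N. ?h (e i j) * (x ^ i * t ^ j)) \<in> Q"
        using dependent_mod[OF E Q, of x t] by blast
      \<comment> \<open>The dependence holds over the fraction field. Clearing denominators yields
        coefficients \<open>f i\<close> in \<open>B[t]\<close>, and a nonzero \<open>f i\<close>
        stays outside \<open>Q\<close> because \<open>t\<close> is transcendental.\<close>
      obtain b where b: "b \<in> B" "b \<noteq> 0" "\<forall>ij\<in>{..<N} \<times> {..<N}. b * e (fst ij) (snd ij) \<in> B"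
        using common_denominator[OF B, of "{..<N} \<times> {..<N}" "\<lambda>ij. e (fst ij) (snd ij)"] e(1) by auto
      define f where "f i = (\<Sum>j<N. monom (b * e i j) j)" for i
      have cf: "coeff (f i) j = (if j < N then b * e i j else 0)" for i j
        by (simp add: f_def coeff_sum_monom)
      have fPB: "f i \<in> PB" if "i < N" for i using that b(3) B_closed by (auto simp: PB_def cf)
      define p where "p = (\<Sum>i<N. monom (poly (map_poly ?h (f i)) t) i)"
      have co: "coeff p i = (if i < N then poly (map_poly ?h (f i)) t else 0)" for i
        by (simp add: p_def coeff_sum_monom)
      have "coeff p i \<in> (\<lambda>f. poly (map_poly ?h f) t) ` PB" for i
      proof (cases "i < N")
        case False
        then show ?thesis using is_subringD(1)[OF PB_subring] by (intro image_eqI[of _ _ 0]) (auto simp: co)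
      qed (use fPB in \<open>auto simp: co\<close>)
      moreover have "\<exists>i. coeff p i \<notin> Q"
      proof -
        obtain i j where ij: "i < N" "j < N" "e i j \<noteq> 0" using e(2) by blast
        then have "coeff (f i) j \<noteq> 0" using b by (simp add: cf)
        then have "f i \<noteq> 0" by auto
        then show ?thesis using trans[OF fPB[OF ij(1)]] ij(1) by (intro exI[of _ i]) (auto simp: co)
      qed
      moreover have "poly p x \<in> Q"
      proof -
        have "poly p x = (\<Sum>i<N. (\<Sum>j<N. ?h (b * e i j) * t ^ j) * x ^ i)"
          unfolding p_def poly_sum poly_monom
          by (intro sum.cong refl) (subst \<theta>[of N], auto simp: cf intro!: sum.cong)
        also have "\<dots> = ?h b * (\<Sum>i<N. \<Sum>j<N. ?h (e i j) * (x ^ i * t ^ j))"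
          by (simp add: sum_distrib_left sum_distrib_right hom mult_ac)
        also have "\<dots> \<in> Q" using e(3) Q(1) by (auto simp: prime_ideal_def is_ideal_def)
        finally show ?thesis .
      qed
      ultimately show "\<exists>p. (\<forall>i. coeff p i \<in> (\<lambda>f. poly (map_poly ?h f) t) ` PB) \<and>
        (\<exists>i. coeff p i \<notin> Q) \<and> poly p x \<in> Q" by blast
    qed
  qed
qed

section \<open>Existence of a base ring over which the field is algebraic\<close>

lemma is_subring_range_of_int: "is_subring (range (of_int :: int \<Rightarrow> 'k::comm_ring_1))"
  unfolding is_subring_def
  by (auto intro: range_eqI[of _ _ "_ + _"] range_eqI[of _ _ "_ - _"] range_eqI[of _ _ "_ * _"]
      range_eqI[of _ _ 0] range_eqI[of _ _ 1])

lemma sized_ring_of_int: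
  assumes char: "CHAR('k::field) = 0"
  shows "\<exists>size. sized_ring (range of_int) (2 :: 'k) size"
proof -
  have eq: "of_int a = (of_int b :: 'k) \<longleftrightarrow> a = b" for a b
    using of_int_eq_0_iff_char_dvd[of "a - b", where 'a = 'k] char by simp
  have inj: "inj (of_int :: int \<Rightarrow> 'k)" by (rule injI) (simp add: eq)
  define size where "size x = nat \<bar>inv (of_int :: int \<Rightarrow> 'k) x\<bar>" for x
  have size: "size (of_int a) = nat \<bar>a\<bar>" for a by (simp add: size_def inv_f_f[OF inj])
  have "sized_ring (range of_int) (2 :: 'k) size"
  proof
    show "is_subring (range (of_int :: int \<Rightarrow> 'k))" by (rule is_subring_range_of_int)
    show "(2::'k) \<in> range of_int" by (rule range_eqI[of _ _ 2]) simp
    show "(2::'k) \<noteq> 0" using eq[of 2 0] by simp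
  next
    fix a b :: 'k assume "a \<in> range of_int" "b \<in> range of_int"
    then obtain a' b' where ab: "a = of_int a'" "b = of_int b'" by blast
    show "size (a + b) \<le> size a + size b" "size (a - b) \<le> size a + size b" "size (a * b) \<le> size a * size b"
      unfolding ab of_int_add[symmetric] of_int_diff[symmetric] of_int_mult[symmetric] size
      by (auto simp: abs_mult nat_mult_distrib)
  next
    fix c :: 'k and e assume "c \<in> range of_int" "c \<noteq> 0"
    then obtain c' where c: "c = of_int c'" "c' \<noteq> 0" by (metis imageE of_int_0)
    have "size (2 ^ e * c) = nat \<bar>2 ^ e * c'\<bar>"
      unfolding c(1) size[symmetric] by simp
    also have "\<dots> = 2 ^ e * nat \<bar>c'\<bar>" by (simp add: abs_mult nat_mult_distrib nat_power_eq)
    finally have "size (2 ^ e * c) = 2 ^ e * nat \<bar>c'\<bar>" .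
    then show "2 ^ e \<le> size (2 ^ e * c)" using c(2) by simp
  next
    fix b :: 'k assume b: "b \<in> range of_int" "b \<notin> (*) 2 ` range of_int"
    then obtain b' where b': "b = of_int b'" by blast
    have "odd b'"
    proof
      assume "even b'"
      then obtain d where "b' = 2 * d" by blast
      then have "b = 2 * of_int d" using b' by simp
      then show False using b(2) by blast
    qed
    then have "even (1 - b')" by simp
    then obtain d where "1 - b' = 2 * d" by blast
    \<comment> \<open>The residue field has two elements, so \<open>r = 1\<close> inverts every odd
      number.\<close>
    then have "1 - 1 * b = 2 * of_int d"
      unfolding b' by (metis mult_1 of_int_1 of_int_diff of_int_mult of_int_numeral)
    moreover have "1 \<in> range (of_int :: int \<Rightarrow> 'k)" by (rule range_eqI[of _ _ 1]) simp
    ultimately show "\<exists>r\<in>range of_int. 1 - r * b \<in> (*) 2 ` range of_int" by blast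
  qed
  then show ?thesis by blast
qed

text \<open>An equation for \<open>y\<close> involves finitely many coefficients, all in one member
  of a chain, so unions of chains stay admissible for Zorn's lemma.\<close>

lemma maximal_transcendental_subring:
  fixes y :: "'k::field"
  assumes "is_subring Z" "\<not> algebraic_over Z y"
  obtains L where "is_subring L" "\<not> algebraic_over L y"
    "\<And>L'. is_subring L' \<Longrightarrow> L \<subseteq> L' \<Longrightarrow> \<not> algebraic_over L' y \<Longrightarrow> L' = L"
proof -
  let ?A = "{L. is_subring L \<and> \<not> algebraic_over L y}"
  have "\<exists>L\<in>?A. \<forall>L'\<in>?A. L \<subseteq> L' \<longrightarrow> L' = L"
  proof (rule subset_Zorn_nonempty)
    show "?A \<noteq> {}" using assms by blast
    fix C assume C: "C \<noteq> {}" "subset.chain ?A C"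
    have CA: "L \<in> ?A" if "L \<in> C" for L using C(2) that by (auto simp: subset.chain_def)
    have fin: "\<exists>L\<in>C. X \<subseteq> L" if "finite X" "X \<subseteq> \<Union>C" for X
      using finite_subset_Union_chain[OF that C] by blast
    have "is_subring (\<Union>C)"
    proof -
      have "a + b \<in> \<Union>C \<and> a - b \<in> \<Union>C \<and> a * b \<in> \<Union>C" if "a \<in> \<Union>C" "b \<in> \<Union>C" for a b
      proof -
        obtain L where L: "L \<in> C" "a \<in> L" "b \<in> L" using fin[of "{a, b}"] \<open>a \<in> \<Union>C\<close> \<open>b \<in> \<Union>C\<close> by auto
        then have "a + b \<in> L \<and> a - b \<in> L \<and> a * b \<in> L" using CA[OF L(1)] by (auto simp: is_subringD)
        then show ?thesis using L(1) by blast
      qed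
      moreover have "0 \<in> \<Union>C" "1 \<in> \<Union>C" using C(1) CA is_subringD(1,2) by fastforce+
      ultimately show ?thesis by (auto simp: is_subring_def)
    qed
    moreover have "\<not> algebraic_over (\<Union>C) y"
    proof
      assume "algebraic_over (\<Union>C) y"
      then obtain q where q: "q \<noteq> 0" "\<And>i. coeff q i \<in> \<Union>C" "poly q y = 0"
        unfolding algebraic_over_def by blast
      obtain L where L: "L \<in> C" "coeff q ` {..degree q} \<subseteq> L" using fin[of "coeff q ` {..degree q}"] q(2) by blast
      have "coeff q i \<in> L" for i
        using L CA[OF L(1)] is_subringD(1)[of L] by (cases "i \<le> degree q") (auto simp: coeff_eq_0)
      then show False using CA[OF L(1)] q by (auto simp: algebraic_over_def)
    qed
    ultimately show "\<Union>C \<in> ?A" by blast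
  qed
  then show thesis using that by blast
qed

text \<open>The equation of \<open>y\<close> over \<open>L[z]\<close> becomes a relation in
  \<open>y\<close> and \<open>z\<close> with uniform bounds, ready to be reordered by powers of
  \<open>z\<close> or cleared of denominators.\<close>

lemma algebraic_over_adjoin:
  fixes y z :: "'k::field"
  assumes L: "is_subring L" and y: "algebraic_over {poly p z | p. \<forall>i. coeff p i \<in> L} y"
  shows "\<exists>n N a. (\<forall>i j. a i j \<in> L) \<and> (\<Sum>i<n::nat. (\<Sum>j<N::nat. a i j * z ^ j) * y ^ i) = 0 \<and>
    (\<exists>i<n. (\<Sum>j<N. a i j * z ^ j) \<noteq> 0)"
proof -
  obtain q where q: "q \<noteq> 0" "\<And>i. \<exists>p. coeff q i = poly p z \<and> (\<forall>j. coeff p j \<in> L)" "poly q y = 0"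
    using y unfolding algebraic_over_def by blast
  obtain p where p: "\<And>i. coeff q i = poly (p i) z" "\<And>i j. coeff (p i) j \<in> L"
    using q(2) by metis
  define n where "n = Suc (degree q)"
  define N where "N = Suc (\<Sum>i<n. degree (p i))"
  have sum_p: "(\<Sum>j<N. coeff (p i) j * z ^ j) = coeff q i" if "i < n" for i
  proof -
    have "degree (p i) < N" unfolding N_def less_Suc_eq_le by (rule member_le_sum) (use that in auto)
    then show ?thesis unfolding p(1) by (subst poly_eq_sum_lessThan[of N]) (auto simp: coeff_eq_0)
  qed
  have "(\<Sum>i<n. (\<Sum>j<N. coeff (p i) j * z ^ j) * y ^ i) = (\<Sum>i<n. coeff q i * y ^ i)"
    using sum_p by (intro sum.cong) auto
  also have "\<dots> = poly q y" by (rule poly_eq_sum_lessThan[symmetric]) (simp add: n_def coeff_eq_0)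
  finally have "(\<Sum>i<n. (\<Sum>j<N. coeff (p i) j * z ^ j) * y ^ i) = 0" using q(3) by simp
  moreover have "\<exists>i<n. (\<Sum>j<N. coeff (p i) j * z ^ j) \<noteq> 0"
    using q(1) sum_p[of "degree q"] by (intro exI[of _ "degree q"]) (auto simp: n_def)
  ultimately show ?thesis
    using p(2) by (intro exI[where x = n] exI[where x = N] exI[where x = "\<lambda>i. coeff (p i)"]) blast
qed

text \<open>Exchange: for \<open>z \<notin> L\<close>, maximality makes \<open>y\<close> algebraic
  over \<open>L[z]\<close>, hence \<open>z\<close> algebraic over \<open>L[y]\<close>. Zorn's lemma
  only provides a subring \<open>L\<close>; the same relation for \<open>z = inverse l\<close> shows
  that \<open>L\<close> is a field, which makes the residue ring \<open>L\<close> of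
  \<open>L[y]\<close> at \<open>y\<close> a field.\<close>

lemma sized_ring_of_transcendental:
  fixes y :: "'k::field"
  assumes Z: "is_subring Z" "\<not> algebraic_over Z y"
  shows "\<exists>B size. sized_ring B y size \<and> (\<forall>a. algebraic_over B a)"
proof -
  obtain L where L: "is_subring L" "\<not> algebraic_over L y"
    and L_max: "\<And>L'. is_subring L' \<Longrightarrow> L \<subseteq> L' \<Longrightarrow> \<not> algebraic_over L' y \<Longrightarrow> L' = L"
    using maximal_transcendental_subring[OF Z] by metis
  note L_closed = is_subringD[OF L(1)]
  define PL where "PL = {f. \<forall>i. coeff f i \<in> L}"
  have PL_pCons: "pCons a f \<in> PL \<longleftrightarrow> a \<in> L \<and> f \<in> PL" for a f
    unfolding PL_def by (auto simp: coeff_pCons split: nat.splits)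
  have PL: "f + g \<in> PL" "f - g \<in> PL" "f * g \<in> PL" if "f \<in> PL" "g \<in> PL" for f g
    using that L_closed by (auto simp: PL_def coeff_mult intro!: is_subring_sum[OF L(1)])
  have trans: "f = 0" if "f \<in> PL" "poly f y = 0" for f
    using L(2) that unfolding algebraic_over_def PL_def by blast
  define B where "B = (\<lambda>f. poly f y) ` PL"
  have "B = {poly f y | f. \<forall>i. coeff f i \<in> L}" by (auto simp: B_def PL_def)
  then have B: "is_subring B" "L \<subseteq> B" "y \<in> B" using subring_poly_values[OF L(1), of y] by auto
  have adjoin: "\<exists>n N a. (\<forall>i j. a i j \<in> L) \<and> (\<Sum>i<n::nat. (\<Sum>j<N::nat. a i j * z ^ j) * y ^ i) = 0 \<and>
    (\<exists>i<n. (\<Sum>j<N. a i j * z ^ j) \<noteq> 0)" if z: "z \<notin> L" for z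
  proof -
    note V = subring_poly_values[OF L(1), of z]
    have "algebraic_over {poly p z | p. \<forall>i. coeff p i \<in> L} y"
      using L_max[OF V(1,2)] V(3) z by auto
    then show ?thesis by (rule algebraic_over_adjoin[OF L(1)])
  qed
  have alg: "algebraic_over B z" for z
  proof (cases "z \<in> L")
    case True
    then have "coeff [:-z, 1:] i \<in> B" for i
      using B is_subringD[OF B(1)] is_subring_uminus[OF B(1)] by (auto simp: coeff_pCons split: nat.split)
    then show ?thesis unfolding algebraic_over_def by (intro exI[of _ "[:-z, 1:]"]) auto
  next
    case False
    then obtain n N a where a: "\<And>i j. a i j \<in> L" "(\<Sum>i<n::nat. (\<Sum>j<N::nat. a i j * z ^ j) * y ^ i) = 0"
      "\<exists>i<n. (\<Sum>j<N. a i j * z ^ j) \<noteq> 0" using adjoin[OF False] by blast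
    \<comment> \<open>The relation is reordered by powers of \<open>z\<close>. It stays nontrivial:
      some \<open>a i j\<close> is nonzero, so \<open>g j\<close> is nonzero, and it does not vanish
      at the transcendental \<open>y\<close>.\<close>
    define g where "g j = (\<Sum>i<n. monom (a i j) i)" for j
    have g: "g j \<in> PL" for j using a(1) L_closed by (auto simp: PL_def g_def coeff_sum_monom)
    define r where "r = (\<Sum>j<N. monom (poly (g j) y) j)"
    obtain i where i: "i < n" "(\<Sum>j<N. a i j * z ^ j) \<noteq> 0" using a(3) by blast
    obtain j where "j \<in> {..<N}" "a i j * z ^ j \<noteq> 0" by (rule sum.not_neutral_contains_not_neutral[OF i(2)])
    with i have ij: "i < n" "j < N" "a i j \<noteq> 0" by auto
    then have "coeff (g j) i \<noteq> 0" by (simp add: g_def coeff_sum_monom)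
    then have "poly (g j) y \<noteq> 0" using trans[OF g, of j] by force
    then have "coeff r j \<noteq> 0" using ij by (simp add: r_def coeff_sum_monom)
    then have "r \<noteq> 0" by auto
    moreover have "coeff r i \<in> B" for i
      using g is_subringD(1)[OF B(1)] by (auto simp: r_def coeff_sum_monom B_def)
    moreover have "poly r z = 0"
    proof -
      have "poly r z = (\<Sum>j<N. \<Sum>i<n. a i j * y ^ i * z ^ j)"
        by (simp add: r_def g_def poly_sum poly_monom sum_distrib_right)
      also have "\<dots> = (\<Sum>i<n. \<Sum>j<N. a i j * y ^ i * z ^ j)" by (rule sum.swap)
      also have "\<dots> = (\<Sum>i<n. (\<Sum>j<N. a i j * z ^ j) * y ^ i)"
        unfolding sum_distrib_right by (intro sum.cong refl) (simp add: mult_ac)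
      finally show ?thesis using a(2) by simp
    qed
    ultimately show ?thesis unfolding algebraic_over_def by blast
  qed
  have L_inverse: "inverse l \<in> L" if l: "l \<in> L" "l \<noteq> 0" for l
  proof (rule ccontr)
    assume "inverse l \<notin> L"
    then obtain n N a where a: "\<And>i j. a i j \<in> L" "(\<Sum>i<n::nat. (\<Sum>j<N::nat. a i j * inverse l ^ j) * y ^ i) = 0"
      "\<exists>i<n. (\<Sum>j<N. a i j * inverse l ^ j) \<noteq> 0" using adjoin by blast
    \<comment> \<open>The factor \<open>l ^ N\<close> clears the denominators and turns the relation
      into an equation for \<open>y\<close> over \<open>L\<close>.\<close>
    define b where "b i = (\<Sum>j<N. a i j * l ^ (N - j))" for i
    have b: "l ^ N * (\<Sum>j<N. a i j * inverse l ^ j) = b i" for i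
      unfolding b_def sum_distrib_left
    proof (rule sum.cong[OF refl])
      fix j assume "j \<in> {..<N}"
      then have "l ^ N = l ^ (N - j) * l ^ j" by (simp flip: power_add)
      then show "l ^ N * (a i j * inverse l ^ j) = a i j * l ^ (N - j)"
        using l(2) by (simp add: power_inverse)
    qed
    have "b i \<in> L" for i unfolding b_def
      by (intro is_subring_sum[OF L(1)] L_closed(5) a is_subring_power[OF L(1)] l)
    then have "(\<Sum>i<n. monom (b i) i) \<in> PL" using L_closed by (auto simp: PL_def coeff_sum_monom)
    moreover have "poly (\<Sum>i<n. monom (b i) i) y = 0"
    proof -
      have "poly (\<Sum>i<n. monom (b i) i) y = l ^ N * (\<Sum>i<n. (\<Sum>j<N. a i j * inverse l ^ j) * y ^ i)"
        by (simp add: poly_sum poly_monom sum_distrib_left[of "l ^ N" _ "{..<n}"] flip: b mult.assoc)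
      then show ?thesis using a(2) by simp
    qed
    ultimately have "(\<Sum>i<n. monom (b i) i) = 0" by (rule trans)
    then have "b i = 0" if "i < n" for i using coeff_sum_monom[of b n i] that by simp
    then show False using a(3) b l by (metis mult_eq_0_iff power_not_zero)
  qed
  define pol where "pol b = (SOME f. f \<in> PL \<and> poly f y = b)" for b
  have pol: "pol (poly f y) = f" if "f \<in> PL" for f
  proof -
    have "pol (poly f y) \<in> PL \<and> poly (pol (poly f y)) y = poly f y"
      unfolding pol_def by (rule someI[of _ f]) (use that in simp)
    then show ?thesis using trans[of "pol (poly f y) - f"] PL that by auto
  qed
  \<comment> \<open>The exponential makes degrees add under multiplication of sizes, and its base is
    the one demanded by \<open>size_power\<close>.\<close>
  define size where "size b = (2::nat) ^ degree (pol b)" for b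
  have size: "size (poly f y) = 2 ^ degree f" if "f \<in> PL" for f
    using pol[OF that] by (simp add: size_def)
  have "sized_ring B y size"
  proof
    show "is_subring B" "y \<in> B" by (fact B)+
    show "y \<noteq> 0"
    proof
      assume "y = 0"
      then have "[:0, 1:] = (0 :: 'k poly)" 
        using L_closed(1,2) by (intro trans) (auto simp: PL_def coeff_pCons split: nat.splits)
      then show False by simp
    qed
  next
    fix a b assume "a \<in> B" "b \<in> B"
    then obtain f g where ab: "a = poly f y" "b = poly g y" and fg: "f \<in> PL" "g \<in> PL" by (auto simp: B_def)
    have two: "(2::nat) ^ max (degree f) (degree g) \<le> 2 ^ degree f + 2 ^ degree g"
      by (cases "degree f \<le> degree g") (auto simp: max_def)
    have "size (a + b) \<le> 2 ^ max (degree f) (degree g)"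
      unfolding ab poly_add[symmetric] size[OF PL(1)[OF fg]]
      by (intro power_increasing degree_add_le_max) auto
    then show "size (a + b) \<le> size a + size b" using two by (simp add: ab size fg)
    have "size (a - b) \<le> 2 ^ max (degree f) (degree g)"
      unfolding ab poly_diff[symmetric] size[OF PL(2)[OF fg]]
      by (intro power_increasing degree_diff_le_max) auto
    then show "size (a - b) \<le> size a + size b" using two by (simp add: ab size fg)
    show "size (a * b) \<le> size a * size b"
      unfolding ab poly_mult[symmetric] size[OF PL(3)[OF fg]] size[OF fg(1)] size[OF fg(2)] power_add[symmetric]
      by (intro power_increasing degree_mult_le) auto
  next
    fix c e assume c: "c \<in> B" "c \<noteq> 0"
    then obtain f where f: "c = poly f y" "f \<in> PL" by (auto simp: B_def)
    with c(2) have "f \<noteq> 0" by auto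
    have "monom 1 e * f \<in> PL" using f(2) L_closed by (auto simp: PL_def coeff_monom_mult)
    then have "size (poly (monom 1 e * f) y) = 2 ^ degree (monom 1 e * f)" by (rule size)
    also have "degree (monom 1 e * f) = e + degree f"
      using \<open>f \<noteq> 0\<close> by (simp add: degree_mult_eq degree_monom_eq)
    finally show "2 ^ e \<le> size (y ^ e * c)" by (simp add: f poly_monom power_add)
  next
    fix b assume b: "b \<in> B" "b \<notin> (*) y ` B"
    then obtain f where f: "b = poly f y" "f \<in> PL" by (auto simp: B_def)
    obtain a g where ag: "f = pCons a g" by (cases f)
    then have ag': "a \<in> L" "g \<in> PL" using f(2) by (auto simp: PL_pCons)
    have gB: "poly g y \<in> B" using ag' by (auto simp: B_def)
    have "a \<noteq> 0" using b(2) f ag gB by auto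
    then have inv: "inverse a \<in> B" using L_inverse ag' B(2) by auto
    have "1 - inverse a * b = y * - (inverse a * poly g y)"
      using \<open>a \<noteq> 0\<close> by (simp add: f ag algebra_simps)
    moreover have "- (inverse a * poly g y) \<in> B"
      by (intro is_subring_uminus[OF B(1)] is_subringD(5)[OF B(1)] inv gB)
    ultimately show "\<exists>r\<in>B. 1 - r * b \<in> (*) y ` B" using inv by blast
  qed
  then show ?thesis using alg by blast
qed

text \<open>If the field is algebraic over the prime ring, positive characteristic would make it
  absolutely algebraic, so the prime ring is a copy of \<open>\<int>\<close> and serves as
  \<open>B\<close>. Otherwise any \<open>y\<close> transcendental over the prime ring starts the
  construction of \<open>L[y]\<close>.\<close>

lemma sized_ring_exists:
  assumes "\<not> absolutely_algebraic TYPE('k::field)"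
  shows "\<exists>B (y::'k) size. sized_ring B y size \<and> (\<forall>a. algebraic_over B a)"
proof (cases "\<exists>y::'k. \<not> algebraic_over (range of_int) y")
  case True
  then show ?thesis using sized_ring_of_transcendental[OF is_subring_range_of_int] by blast
next
  case False
  have "CHAR('k) = 0"
  proof (rule ccontr)
    assume "CHAR('k) \<noteq> 0"
    then have pos: "CHAR('k) > 0" by simp
    \<comment> \<open>\<open>absolutely_algebraic\<close> takes coefficients from the image of
      \<open>of_nat\<close>; in positive characteristic this is the whole prime ring.\<close>
    have "of_int a \<in> range (of_nat :: nat \<Rightarrow> 'k)" for a
    proof -
      have "int CHAR('k) dvd a - a mod int CHAR('k)" by simp
      then have "of_int (a - a mod int CHAR('k)) = (0 :: 'k)" by (simp only: of_int_eq_0_iff_char_dvd)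
      then have "(of_int a :: 'k) = of_int (int (nat (a mod int CHAR('k))))" using pos by simp
      then show ?thesis by (metis of_int_of_nat_eq rangeI)
    qed
    then have "range (of_int :: int \<Rightarrow> 'k) \<subseteq> range of_nat" by blast
    then have "\<forall>x::'k. \<exists>q. q \<noteq> 0 \<and> (\<forall>i. coeff q i \<in> range of_nat) \<and> poly q x = 0"
      using False unfolding algebraic_over_def by (meson subsetD)
    then have "absolutely_algebraic TYPE('k)"
      using prime_CHAR_semidom[OF pos] unfolding absolutely_algebraic_def by simp
    then show False using assms by simp
  qed
  then show ?thesis using sized_ring_of_int False by blast
qed

theorem theorem3p5:
  fixes Q :: "(('v::finite \<Rightarrow>\<^sub>0 nat) \<Rightarrow>\<^sub>0 'k::alg_closed_field) set"
  assumes "\<not> absolutely_algebraic TYPE('k)"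
    and "prime_ideal Q"
    and "enat (CARD('v) - 1) \<le> height Q"
    and "height Q \<le> enat CARD('v)"
  shows "\<exists>S :: (('v \<Rightarrow>\<^sub>0 nat) \<Rightarrow>\<^sub>0 'k) set.
           maximal_subring S \<and> integrally_closed_in_ambient S \<and> conductor S = Q"
proof -
  obtain B y size where "sized_ring B (y::'k) size" "\<And>a. algebraic_over B a"
    using sized_ring_exists[OF assms(1)] by blast
  then show ?thesis using sized_ring.maximal_subring_with_conductor assms(2,3) by blast
qed

end
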